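(* Let $n>i\ge 4$ be integers and let $\mathbb F$ be a field containing $\frac12$ and elements $\alpha,c$, such that all the denominators appearing below are nonzero and the identity elements below exist. Put $$\eta_\alpha(j)=\frac{\alpha(j+1)}{2+2\alpha(j-1)},\qquad \hat\eta_\alpha(j)=\frac{\alpha j}{1+\alpha(j-1)}.$$ In the algebra $A=M_\alpha^c(\mathcal A_n^\pm)$ over $\mathbb F$, with $e_i=\mathrm{id}_i-\mathrm{id}_{i-1}$ and $\hat e_i=\hat{\mathrm{id}}_i-\mathrm{id}_i$, one has $$\begin{aligned}\mathrm{Spec}(e_i)=\{&1,\,0,\,\eta_\alpha(i),\,1-\eta_\alpha(i-1),\,\eta_\alpha(i)-\eta_\alpha(i-1),\\&\hat\eta_\alpha(i)-\eta_\alpha(i-1),\,\hat\eta_\alpha(i)-\hat\eta_\alpha(i-1)\},\end{aligned}$$ $$\mathrm{Spec}(\hat e_n)=\{1,\,0,\,1-\eta_\alpha(n),\,1-\hat\eta_\alpha(n)\},$$ $$\mathrm{cc}(e_i)=\frac c2\,\frac{i(2+\alpha(i-3))}{(1+\alpha(i-1))(1+\alpha(i-2))},$$ $$\mathrm{cc}(\hat e_i)=\frac c2\,\frac{i(i+1)}{(1+2\alpha(i-1))(1+\alpha(i-1))}.$$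
   Context: **Fischer spaces.** $\mathcal A_j$ denotes the Fischer space of the Weyl group $\mathrm{Sym}(j+1)$ of the root system $A_j$: its points are the transpositions of $\mathrm{Sym}(j+1)$ and its lines are the sets $\{(a,b),(b,d),(a,d)\}$ for distinct letters $a,b,d$; $\mathcal A_0=\emptyset$. For distinct points $x,y$ write $x\sim y$ if they lie on a common line, whose third point is $x\wedge y$; otherwise $x\not\sim y$. **Double graph.** For a Fischer space $\mathcal G$, $\mathcal G^\pm$ has points $x^+,x^-$ for $x\in\mathcal G$ and lines $\{x^\varepsilon,y^\eta,(x\wedge y)^{\varepsilon\eta}\}$ for $x\sim y$ in $\mathcal G$ and signs $\varepsilon,\eta\in\{+,-\}$. $\mathcal G$ is viewed inside $\mathcal G^\pm$ via $x\mapsto x^+$. ($\mathcal A_n^\pm$ is again a Fischer space.) **Matsuo algebra.** $M_\alpha(\mathcal G)_{\mathbb F}$ is the $\mathbb F$-vector space with basis the points of $\mathcal G$ and bilinear product $xx=x$; $xy=0$ if $x\neq y$ and $x\not\sim y$; $xy=\frac\alpha2(x+y-x\wedge y)$ if $x\sim y$. The notation $M_\alpha^c(\mathcal G)$ means this algebra equipped with the symmetric bilinear form given on points by $(x,x)=2c$, $(x,y)=0$ if $x\ne y$, $x\not\sim y$, and $(x,y)=c\alpha$ if $x\sim y$. The central charge of an idempotent $e$ is $\mathrm{cc}(e)=\frac12(e,e)$. $\mathrm{Spec}(e)$ is the set of eigenvalues of left multiplication by $e$ on $A$. **Idempotents.** Fix the embeddings $\mathcal A_0\subseteq\mathcal A_1\subseteq\dots\subseteq\mathcal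 A_n$ coming from $\mathrm{Sym}(1)\subseteq\mathrm{Sym}(2)\subseteq\dots\subseteq\mathrm{Sym}(n+1)$. Let $\mathrm{id}_j$ be the identity element of the subalgebra of $A$ spanned by $\mathcal A_j\subseteq\mathcal A_n\subseteq\mathcal A_n^\pm$ and let $\hat{\mathrm{id}}_j$ be the identity element of the subalgebra spanned by $\mathcal A_j^\pm\subseteq\mathcal A_n^\pm$. *)

theory Defs
  imports Complex_Main "HOL-Library.Poly_Mapping" "HOL-Combinatorics.Transposition"
begin

section \<open>Point-line geometries, the Fischer spaces of type A, and the double graph\<close>

record 'p geometry =
  points :: "'p set"
  lines :: "'p set set"

text \<open>The relation \<open>x \<sim> y\<close>; distinctness of the two points is part of it.\<close>

definition collinear :: "'p geometry \<Rightarrow> 'p \<Rightarrow> 'p \<Rightarrow> bool" where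
  "collinear G x y \<longleftrightarrow>
     x \<in> points G \<and> y \<in> points G \<and> x \<noteq> y \<and> (\<exists>l\<in>lines G. x \<in> l \<and> y \<in> l)"

text \<open>Only meaningful if \<open>collinear G x y\<close> (in a Fischer space two points lie on at most one line,
  and every line has three points).\<close>

definition wedge :: "'p geometry \<Rightarrow> 'p \<Rightarrow> 'p \<Rightarrow> 'p" where
  "wedge G x y = (THE z. z \<noteq> x \<and> z \<noteq> y \<and> {x, y, z} \<in> lines G)"

text \<open>\<open>Sym(j + 1)\<close> acts on the letters \<open>1, \<dots>, j + 1\<close>. Its transpositions are functions on all
  of \<open>nat\<close>, so the embeddings \<open>fischer_A j \<subseteq> fischer_A n\<close> for \<open>j \<le> n\<close> are literal inclusions.\<close>

definition fischer_A :: "nat \<Rightarrow> (nat \<Rightarrow> nat) geometry" where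
  "fischer_A j =
    \<lparr> points = {transpose a b | a b. a \<in> {1..j+1} \<and> b \<in> {1..j+1} \<and> a \<noteq> b},
      lines = {{transpose a b, transpose b d, transpose a d} | a b d.
                 a \<in> {1..j+1} \<and> b \<in> {1..j+1} \<and> d \<in> {1..j+1} \<and> a \<noteq> b \<and> b \<noteq> d \<and> a \<noteq> d} \<rparr>"

datatype sign = Pos | Neg

fun sign_mult :: "sign \<Rightarrow> sign \<Rightarrow> sign" where
  "sign_mult Pos s = s"
| "sign_mult Neg Pos = Neg"
| "sign_mult Neg Neg = Pos"

definition double_graph :: "'p geometry \<Rightarrow> ('p \<times> sign) geometry" where
  "double_graph G =
    \<lparr> points = points G \<times> UNIV,
      lines = {{(x, s), (y, t), (wedge G x y, sign_mult s t)} | x y s t. collinear G x y} \<rparr>"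


section \<open>Matsuo algebras\<close>

text \<open>Vectors are finitely supported functions from points to the field; the point \<open>x\<close> itself is
  the vector \<open>pt x\<close>.\<close>

definition scale :: "'a::field \<Rightarrow> ('p \<Rightarrow>\<^sub>0 'a) \<Rightarrow> ('p \<Rightarrow>\<^sub>0 'a)" where
  "scale k v = Poly_Mapping.map ((*) k) v"

lemma lookup_scale [simp]: "Poly_Mapping.lookup (scale k v) x = k * Poly_Mapping.lookup v x"
  by (simp add: scale_def Poly_Mapping.map.rep_eq when_def)

interpretation free: vector_space scale
  by unfold_locales (auto intro!: poly_mapping_eqI simp: lookup_add algebra_simps)

abbreviation pt :: "'p \<Rightarrow> ('p \<Rightarrow>\<^sub>0 'a::field)" where
  "pt x \<equiv> Poly_Mapping.single x 1"

definition matsuo_carrier :: "'p geometry \<Rightarrow> ('p \<Rightarrow>\<^sub>0 'a::field) set" where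
  "matsuo_carrier G = {v. Poly_Mapping.keys v \<subseteq> points G}"

definition point_mult :: "'a::field \<Rightarrow> 'p geometry \<Rightarrow> 'p \<Rightarrow> 'p \<Rightarrow> ('p \<Rightarrow>\<^sub>0 'a)" where
  "point_mult \<alpha> G x y =
    (if x = y then pt x
     else if collinear G x y then scale (\<alpha> / 2) (pt x + pt y - pt (wedge G x y))
     else 0)"

definition matsuo_mult ::
    "'a::field \<Rightarrow> 'p geometry \<Rightarrow> ('p \<Rightarrow>\<^sub>0 'a) \<Rightarrow> ('p \<Rightarrow>\<^sub>0 'a) \<Rightarrow> ('p \<Rightarrow>\<^sub>0 'a)" where
  "matsuo_mult \<alpha> G v w =
    (\<Sum>x\<in>Poly_Mapping.keys v. \<Sum>y\<in>Poly_Mapping.keys w.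
      scale (Poly_Mapping.lookup v x * Poly_Mapping.lookup w y) (point_mult \<alpha> G x y))"

definition point_form :: "'a::field \<Rightarrow> 'a \<Rightarrow> 'p geometry \<Rightarrow> 'p \<Rightarrow> 'p \<Rightarrow> 'a" where
  "point_form \<alpha> c G x y = (if x = y then 2 * c else if collinear G x y then c * \<alpha> else 0)"

definition matsuo_form ::
    "'a::field \<Rightarrow> 'a \<Rightarrow> 'p geometry \<Rightarrow> ('p \<Rightarrow>\<^sub>0 'a) \<Rightarrow> ('p \<Rightarrow>\<^sub>0 'a) \<Rightarrow> 'a" where
  "matsuo_form \<alpha> c G v w =
    (\<Sum>x\<in>Poly_Mapping.keys v. \<Sum>y\<in>Poly_Mapping.keys w.
      Poly_Mapping.lookup v x * Poly_Mapping.lookup w y * point_form \<alpha> c G x y)"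

definition central_charge :: "'a::field \<Rightarrow> 'a \<Rightarrow> 'p geometry \<Rightarrow> ('p \<Rightarrow>\<^sub>0 'a) \<Rightarrow> 'a" where
  "central_charge \<alpha> c G e = 1 / 2 * matsuo_form \<alpha> c G e e"

definition Spec :: "'a::field \<Rightarrow> 'p geometry \<Rightarrow> ('p \<Rightarrow>\<^sub>0 'a) \<Rightarrow> 'a set" where
  "Spec \<alpha> G e =
    {k. \<exists>v\<in>matsuo_carrier G. v \<noteq> 0 \<and> matsuo_mult \<alpha> G e v = scale k v}"


section \<open>Identity elements of subalgebras and the idempotents\<close>

definition is_identity ::
    "'a::field \<Rightarrow> 'p geometry \<Rightarrow> ('p \<Rightarrow>\<^sub>0 'a) set \<Rightarrow> ('p \<Rightarrow>\<^sub>0 'a) \<Rightarrow> bool" where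
  "is_identity \<alpha> G B u \<longleftrightarrow>
     u \<in> B \<and> (\<forall>v\<in>B. matsuo_mult \<alpha> G u v = v \<and> matsuo_mult \<alpha> G v u = v)"

definition has_identity :: "'a::field \<Rightarrow> 'p geometry \<Rightarrow> ('p \<Rightarrow>\<^sub>0 'a) set \<Rightarrow> bool" where
  "has_identity \<alpha> G B \<longleftrightarrow> (\<exists>u. is_identity \<alpha> G B u)"

text \<open>An identity element is unique if it exists, so \<open>the_identity\<close> is well defined under
  \<open>has_identity\<close>.\<close>

definition the_identity :: "'a::field \<Rightarrow> 'p geometry \<Rightarrow> ('p \<Rightarrow>\<^sub>0 'a) set \<Rightarrow> ('p \<Rightarrow>\<^sub>0 'a)" where
  "the_identity \<alpha> G B = (THE u. is_identity \<alpha> G B u)"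

text \<open>The subspaces spanned by \<open>\<A>\<^sub>j\<close>, identified with its copy \<open>x\<^sup>+\<close>, and by its double.\<close>

definition sub_A :: "nat \<Rightarrow> ((nat \<Rightarrow> nat) \<times> sign \<Rightarrow>\<^sub>0 'a::field) set" where
  "sub_A j = free.span ((\<lambda>x. pt (x, Pos)) ` points (fischer_A j))"

definition sub_A_double :: "nat \<Rightarrow> ((nat \<Rightarrow> nat) \<times> sign \<Rightarrow>\<^sub>0 'a::field) set" where
  "sub_A_double j = free.span (pt ` points (double_graph (fischer_A j)))"

text \<open>In the following \<open>n\<close> indexes the ambient algebra, the Matsuo algebra of
  \<open>double_graph (fischer_A n)\<close>.\<close>

definition ident :: "'a::field \<Rightarrow> nat \<Rightarrow> nat \<Rightarrow> ((nat \<Rightarrow> nat) \<times> sign \<Rightarrow>\<^sub>0 'a)" where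
  "ident \<alpha> n j = the_identity \<alpha> (double_graph (fischer_A n)) (sub_A j)"

definition ident_hat :: "'a::field \<Rightarrow> nat \<Rightarrow> nat \<Rightarrow> ((nat \<Rightarrow> nat) \<times> sign \<Rightarrow>\<^sub>0 'a)" where
  "ident_hat \<alpha> n j = the_identity \<alpha> (double_graph (fischer_A n)) (sub_A_double j)"

definition idem :: "'a::field \<Rightarrow> nat \<Rightarrow> nat \<Rightarrow> ((nat \<Rightarrow> nat) \<times> sign \<Rightarrow>\<^sub>0 'a)" where
  "idem \<alpha> n i = ident \<alpha> n i - ident \<alpha> n (i - 1)"

definition idem_hat :: "'a::field \<Rightarrow> nat \<Rightarrow> nat \<Rightarrow> ((nat \<Rightarrow> nat) \<times> sign \<Rightarrow>\<^sub>0 'a)" where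
  "idem_hat \<alpha> n i = ident_hat \<alpha> n i - ident \<alpha> n i"

text \<open>The subtraction \<open>j - 1\<close> is carried out in the field.\<close>

definition eta :: "'a::field \<Rightarrow> nat \<Rightarrow> 'a" where
  "eta \<alpha> j = \<alpha> * (of_nat j + 1) / (2 + 2 * \<alpha> * (of_nat j - 1))"

definition eta_hat :: "'a::field \<Rightarrow> nat \<Rightarrow> 'a" where
  "eta_hat \<alpha> j = \<alpha> * of_nat j / (1 + \<alpha> * (of_nat j - 1))"

end

theory Submission
  imports Defs
begin

text \<open>
Let \<open>S\<^sub>j\<close> be the sum of the points of \<open>\<A>\<^sub>j\<close> (with sign \<open>+\<close>) and put \<open>\<beta> = \<alpha> / 2\<close>.  If \<open>X\<close> is a set of
points closed under \<open>\<and>\<close> in which every point has \<open>k\<close> neighbours, then for \<open>x \<in> X\<close> the product of \<open>x\<close>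
with the sum of \<open>X\<close> is \<open>x + \<beta> \<Sum>\<^sub>y (x + y - x \<and> y)\<close> over the neighbours \<open>y\<close>, and \<open>y\<close> and \<open>x \<and> y\<close> run
through the same points, so that only \<open>(1 + \<beta> k) x\<close> is left.  Hence identity elements of such
subalgebras are normalised sums of points (\<open>the_identity_eq\<close>): the degree is \<open>2 (j - 1)\<close> for \<open>\<A>\<^sub>j\<close>
and \<open>4 (j - 1)\<close> for its double.  Once this is known, the central charges amount to counting points.

For the spectra, read a point \<open>(a, b)\<^sup>\<plusminus>\<close> as a signed edge of the complete graph on the letters and
a vector as a pair of edge weightings.  Multiplication by \<open>S\<^sub>j\<close> then only involves the weight
of an edge itself and the sums of the weights around its two ends, the row sums
(\<open>coord_mult_inside\<close>, \<open>coord_mult_crossing\<close>, \<open>coord_mult_outside\<close>).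

No other eigenvalues occur: suppose that \<open>e v = k v\<close> and \<open>k\<close> is not one of the listed values.
Summing the eigenvalue equations around a letter gives equations for the row sums alone,
which force the row sums to vanish, and after that each weight is multiplied by a scalar different
from \<open>k\<close>.  For \<open>e\<^sub>i\<close> this is applied to the edges leaving the letters of \<open>\<A>\<^sub>i\<close>, then to the negative
edges inside, then to the positive edges at the last letter; what remains lies in \<open>\<A>\<^sub>i\<^sub>-\<^sub>1\<close>, where
\<open>e\<^sub>i\<close> acts as zero (\<open>spectrum_idem_upper\<close>).  Apart from the given denominators, this argument
divides only by \<open>2\<close> and by \<open>k\<close> minus a listed value, so it works in every
characteristic other than \<open>2\<close>, also when multiplication by \<open>e\<^sub>i\<close> cannot be diagonalised.

All values do occur: \<open>1\<close> belongs to the idempotent itself and \<open>0\<close> to \<open>S\<^sub>i\<^sub>-\<^sub>1\<close>.  The other values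
belong to common eigenvectors of \<open>S\<^sub>i\<close> and \<open>S\<^sub>i\<^sub>-\<^sub>1\<close> whose weights have the form
\<open>\<kappa>\<^sub>\<plusminus> (g a * h b + g b * h a)\<close> with \<open>g\<close> and \<open>h\<close> of disjoint support.  For these the row sums factor, and
being an eigenvector becomes a condition on the values of \<open>h\<close> (\<open>eigenvector_outside\<close>,
\<open>eigenvector_inside\<close>).  The coefficients are chosen so that the vectors stay nonzero when
\<open>\<alpha>\<close>, \<open>1 - \<alpha>\<close> or an integer vanishes in the field.  The idempotent \<open>idem_hat \<alpha> n n\<close> is treated in the same
way; there the identity of the double is the identity of the whole algebra.
\<close>

section \<open>Matsuo algebras of geometries with lines of three points\<close>

abbreviation coord :: "('p \<Rightarrow>\<^sub>0 'a::zero) \<Rightarrow> 'p \<Rightarrow> 'a" where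
  "coord \<equiv> Poly_Mapping.lookup"

lemma matsuo_mult_eq_sum:
  assumes "finite X" "finite Y" "Poly_Mapping.keys v \<subseteq> X" "Poly_Mapping.keys w \<subseteq> Y"
  shows "matsuo_mult \<alpha> G v w =
    (\<Sum>x\<in>X. \<Sum>y\<in>Y. scale (coord v x * coord w y) (point_mult \<alpha> G x y))"
proof -
  have "(\<Sum>y\<in>Poly_Mapping.keys w. scale (coord v x * coord w y) (point_mult \<alpha> G x y)) =
      (\<Sum>y\<in>Y. scale (coord v x * coord w y) (point_mult \<alpha> G x y))" for x
    using assms by (intro sum.mono_neutral_left) (auto simp: in_keys_iff)
  then show ?thesis
    unfolding matsuo_mult_def using assms
    by (simp, intro sum.mono_neutral_left) (auto simp: in_keys_iff)
qed

lemma matsuo_form_eq_sum: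
  assumes "finite X" "finite Y" "Poly_Mapping.keys v \<subseteq> X" "Poly_Mapping.keys w \<subseteq> Y"
  shows "matsuo_form \<alpha> c G v w =
    (\<Sum>x\<in>X. \<Sum>y\<in>Y. coord v x * coord w y * point_form \<alpha> c G x y)"
proof -
  have "(\<Sum>y\<in>Poly_Mapping.keys w. coord v x * coord w y * point_form \<alpha> c G x y) =
      (\<Sum>y\<in>Y. coord v x * coord w y * point_form \<alpha> c G x y)" for x
    using assms by (intro sum.mono_neutral_left) (auto simp: in_keys_iff)
  then show ?thesis
    unfolding matsuo_form_def using assms
    by (simp, intro sum.mono_neutral_left) (auto simp: in_keys_iff)
qed

lemma keys_diff_scale_subset:
  "Poly_Mapping.keys (scale a v - scale b w) \<subseteq> Poly_Mapping.keys v \<union> Poly_Mapping.keys w"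
  by (auto simp: in_keys_iff lookup_minus)

lemma matsuo_mult_diff_scale_left:
  "matsuo_mult \<alpha> G (scale a u - scale b v) w =
    scale a (matsuo_mult \<alpha> G u w) - scale b (matsuo_mult \<alpha> G v w)"
proof (rule poly_mapping_eqI)
  fix p
  let ?X = "Poly_Mapping.keys u \<union> Poly_Mapping.keys v" and ?Y = "Poly_Mapping.keys w"
  have expand: "matsuo_mult \<alpha> G x w =
      (\<Sum>p\<in>?X. \<Sum>q\<in>?Y. scale (coord x p * coord w q) (point_mult \<alpha> G p q))"
    if "Poly_Mapping.keys x \<subseteq> ?X" for x
    using that by (intro matsuo_mult_eq_sum) auto
  show "coord (matsuo_mult \<alpha> G (scale a u - scale b v) w) p =
      coord (scale a (matsuo_mult \<alpha> G u w) - scale b (matsuo_mult \<alpha> G v w)) p"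
    unfolding expand[OF keys_diff_scale_subset] expand[OF Un_upper1] expand[OF Un_upper2]
    by (simp only: lookup_sum lookup_scale lookup_minus sum_distrib_left sum_subtractf[symmetric]
        left_diff_distrib mult.assoc)
qed

lemma matsuo_form_diff_scale:
  "matsuo_form \<alpha> c G (scale a u - scale b v) (scale a u - scale b v) =
    a * a * matsuo_form \<alpha> c G u u - a * b * (matsuo_form \<alpha> c G u v + matsuo_form \<alpha> c G v u)
    + b * b * matsuo_form \<alpha> c G v v"
proof -
  let ?X = "Poly_Mapping.keys u \<union> Poly_Mapping.keys v"
  have expand: "matsuo_form \<alpha> c G x y = (\<Sum>p\<in>?X. \<Sum>q\<in>?X. coord x p * coord y q * point_form \<alpha> c G p q)"
    if "Poly_Mapping.keys x \<subseteq> ?X" "Poly_Mapping.keys y \<subseteq> ?X" for x y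
    using that by (intro matsuo_form_eq_sum) auto
  have "matsuo_form \<alpha> c G (scale a u - scale b v) (scale a u - scale b v) =
    (\<Sum>p\<in>?X. \<Sum>q\<in>?X. a * a * (coord u p * coord u q * point_form \<alpha> c G p q)
      - a * b * (coord u p * coord v q * point_form \<alpha> c G p q)
      - a * b * (coord v p * coord u q * point_form \<alpha> c G p q)
      + b * b * (coord v p * coord v q * point_form \<alpha> c G p q))"
    unfolding expand[OF keys_diff_scale_subset keys_diff_scale_subset]
    by (intro sum.cong refl) (simp add: lookup_minus algebra_simps)
  also have "\<dots> = a * a * matsuo_form \<alpha> c G u u - a * b * matsuo_form \<alpha> c G u v
      - a * b * matsuo_form \<alpha> c G v u + b * b * matsuo_form \<alpha> c G v v"
    by (simp only: expand[OF Un_upper1 Un_upper1] expand[OF Un_upper1 Un_upper2]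
        expand[OF Un_upper2 Un_upper1] expand[OF Un_upper2 Un_upper2]
        sum.distrib sum_subtractf sum_distrib_left)
  finally show ?thesis by (simp add: algebra_simps)
qed

lemma span_pt_image:
  "free.span (pt ` X) = {v :: 'p \<Rightarrow>\<^sub>0 'a::field. Poly_Mapping.keys v \<subseteq> X}"
proof (intro antisym subsetI)
  fix v :: "'p \<Rightarrow>\<^sub>0 'a" assume "v \<in> free.span (pt ` X)"
  then show "v \<in> {v. Poly_Mapping.keys v \<subseteq> X}"
  proof (induction rule: free.span_induct_alt)
    case base
    then show ?case by simp
  next
    case (step k w u)
    then show ?case
      by (auto simp: in_keys_iff lookup_add lookup_single when_def split: if_splits)
  qed
next
  fix v :: "'p \<Rightarrow>\<^sub>0 'a" assume "v \<in> {v. Poly_Mapping.keys v \<subseteq> X}"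
  then have v: "Poly_Mapping.keys v \<subseteq> X" by simp
  have "v = (\<Sum>x\<in>Poly_Mapping.keys v. scale (coord v x) (pt x))"
    by (rule poly_mapping_eqI)
       (simp add: lookup_sum lookup_single when_def if_distrib[of "(*) _"] in_keys_iff cong: if_cong)
  moreover have "\<dots> \<in> free.span (pt ` X)"
    using v by (intro free.span_sum free.span_scale free.span_base) auto
  ultimately show "v \<in> free.span (pt ` X)" by metis
qed

lemma is_identity_unique:
  assumes "is_identity \<alpha> G B u" "is_identity \<alpha> G B u'"
  shows "u = u'"
  using assms unfolding is_identity_def by metis

lemma is_identity_the_identity:
  assumes "has_identity \<alpha> G B"
  shows "is_identity \<alpha> G B (the_identity \<alpha> G B)"
proof -
  obtain u where "is_identity \<alpha> G B u"
    using assms has_identity_def by blast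
  then show ?thesis
    unfolding the_identity_def by (metis is_identity_unique the_equality)
qed

definition point_sum :: "'p set \<Rightarrow> ('p \<Rightarrow>\<^sub>0 'a::field)" where
  "point_sum X = (\<Sum>x\<in>X. pt x)"

lemma lookup_point_sum:
  "finite X \<Longrightarrow> coord (point_sum X) p = (if p \<in> X then 1 else 0)"
  by (simp add: point_sum_def lookup_sum lookup_single when_def)

lemma keys_point_sum: "finite X \<Longrightarrow> Poly_Mapping.keys (point_sum X :: 'p \<Rightarrow>\<^sub>0 'a::field) = X"
  by (auto simp: in_keys_iff lookup_point_sum split: if_splits)

lemma collinear_sym: "collinear G x y \<Longrightarrow> collinear G y x"
  by (auto simp: collinear_def)

text \<open>The properties of the third point on a line that the computations below use: \<open>y \<mapsto> x \<and> y\<close> is an involution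
on the neighbours of \<open>x\<close>, and the relation between the three points of a line is symmetric.\<close>

locale triple_system =
  fixes G :: "'p geometry"
  assumes finite_points: "finite (points G)"
    and wedge_commute: "collinear G x y \<Longrightarrow> wedge G x y = wedge G y x"
    and collinear_wedge: "collinear G x y \<Longrightarrow> collinear G x (wedge G x y)"
    and wedge_wedge: "collinear G x y \<Longrightarrow> wedge G x (wedge G x y) = y"
begin

lemma collinear_points: "collinear G x y \<Longrightarrow> x \<in> points G \<and> y \<in> points G \<and> x \<noteq> y"
  by (auto simp: collinear_def)

lemma collinear_iff_wedge:
  "collinear G x y \<and> wedge G x y = p \<longleftrightarrow> collinear G x p \<and> wedge G x p = y"
  using collinear_wedge wedge_wedge by metis

lemma point_mult_commute: "point_mult \<alpha> G x y = point_mult \<alpha> G y x"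
  using wedge_commute[of x y] collinear_sym[of G x y] collinear_sym[of G y x]
  by (auto simp: point_mult_def add.commute)

lemma matsuo_mult_commute: "matsuo_mult \<alpha> G v w = matsuo_mult \<alpha> G w v"
  unfolding matsuo_mult_def
  by (subst sum.swap) (simp add: point_mult_commute mult.commute)

lemma finite_collinear: "finite {y. collinear G x y}"
  by (rule finite_subset[OF _ finite_points]) (use collinear_points in blast)

text \<open>The left hand side is the coordinate at \<open>p\<close> of the product of \<open>x\<close> and \<open>v\<close>.  A neighbour \<open>y\<close> of \<open>x\<close>
contributes at \<open>x\<close>, at \<open>y\<close> and, with negative sign, at \<open>x \<and> y\<close>; the last case reads
\<open>x \<and> y = p\<close>, that is \<open>y = x \<and> p\<close>.\<close>

lemma lookup_pt_mult:
  fixes \<alpha> :: "'a::field"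
  assumes "x \<in> points G" "v \<in> matsuo_carrier G"
  shows "(\<Sum>y\<in>points G. coord v y * coord (point_mult \<alpha> G x y) p) =
    (if p = x then coord v x + \<alpha> / 2 * (\<Sum>y | collinear G x y. coord v y) else 0)
    + (if collinear G x p then \<alpha> / 2 * (coord v p - coord v (wedge G x p)) else 0)"
proof -
  let ?nb = "{y. collinear G x y}"
  have nb: "finite ?nb" "?nb \<subseteq> points G"
    using finite_collinear collinear_points by auto
  have dist: "c * (h * ((if P then 1 else 0) + (if Q then 1 else 0) - (if R then 1 else 0))) =
      h * ((if P then c else 0) + (if Q then c else 0) - (if R then c else 0))"
    for P Q R :: bool and c h :: 'a
    by (simp add: algebra_simps)
  have summand: "coord v y * coord (point_mult \<alpha> G x y) p =
      (if y = x then if p = x then coord v x else 0 else 0)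
      + (if y \<in> ?nb then \<alpha> / 2 * ((if p = x then coord v y else 0) + (if y = p then coord v p else 0)
          - (if y = wedge G x p \<and> collinear G x p then coord v (wedge G x p) else 0)) else 0)" for y
  proof (cases "collinear G x y")
    case True
    then have third: "wedge G x y = p \<longleftrightarrow> y = wedge G x p \<and> collinear G x p"
      using collinear_iff_wedge by metis
    have "coord (point_mult \<alpha> G x y) p =
      \<alpha> / 2 * ((if p = x then 1 else 0) + (if y = p then 1 else 0) - (if wedge G x y = p then 1 else 0))"
      using True collinear_points[OF True]
      by (simp add: point_mult_def lookup_add lookup_minus lookup_single when_def)
    then have "coord v y * coord (point_mult \<alpha> G x y) p =
      \<alpha> / 2 * ((if p = x then coord v y else 0) + (if y = p then coord v y else 0)
        - (if y = wedge G x p \<and> collinear G x p then coord v y else 0))"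
      unfolding third
      by (simp only: dist)
    moreover have "(if y = p then coord v y else 0) = (if y = p then coord v p else 0)"
      "(if y = wedge G x p \<and> collinear G x p then coord v y else 0) =
        (if y = wedge G x p \<and> collinear G x p then coord v (wedge G x p) else 0)"
      by simp_all
    moreover have "y \<noteq> x" using collinear_points[OF True] by blast
    ultimately show ?thesis
      using True by (simp only: mem_Collect_eq if_True if_False add_0_left)
  next
    case False
    then show ?thesis
      by (auto simp: point_mult_def lookup_single when_def)
  qed
  have "(\<Sum>y\<in>points G. coord v y * coord (point_mult \<alpha> G x y) p) =
     (if p = x then coord v x else 0)
     + (\<Sum>y\<in>?nb. \<alpha> / 2 * ((if p = x then coord v y else 0) + (if y = p then coord v p else 0)
          - (if y = wedge G x p \<and> collinear G x p then coord v (wedge G x p) else 0)))"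
    unfolding summand sum.distrib sum.inter_restrict[OF finite_points, symmetric] Int_absorb1[OF nb(2)]
    using assms finite_points by simp
  also have "\<dots> = (if p = x then coord v x else 0) + \<alpha> / 2 *
      ((if p = x then \<Sum>y\<in>?nb. coord v y else 0) + (if collinear G x p then coord v p else 0)
       - (if collinear G x p then coord v (wedge G x p) else 0))"
    unfolding sum_distrib_left[symmetric] sum_subtractf sum.distrib
    using nb(1) collinear_wedge[of x p] by (cases "collinear G x p") auto
  finally show ?thesis by (auto simp: algebra_simps)
qed

lemma lookup_point_sum_mult:
  assumes "X \<subseteq> points G" "v \<in> matsuo_carrier G"
  shows "coord (matsuo_mult \<alpha> G (point_sum X) v) p =
    (if p \<in> X then coord v p + \<alpha> / 2 * (\<Sum>y | collinear G p y. coord v y) else 0)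
    + \<alpha> / 2 * (\<Sum>x | x \<in> X \<and> collinear G x p. coord v p - coord v (wedge G x p))"
proof -
  have fin: "finite X" using assms(1) finite_points finite_subset by blast
  have "coord (matsuo_mult \<alpha> G (point_sum X) v) p =
    (\<Sum>x\<in>X. \<Sum>y\<in>points G. coord v y * coord (point_mult \<alpha> G x y) p)"
    using assms(2)
    by (subst matsuo_mult_eq_sum[OF fin finite_points])
       (simp_all add: keys_point_sum fin lookup_point_sum lookup_sum matsuo_carrier_def)
  also have "\<dots> = (\<Sum>x\<in>X. (if p = x then coord v x + \<alpha> / 2 * (\<Sum>y | collinear G x y. coord v y) else 0)
      + (if collinear G x p then \<alpha> / 2 * (coord v p - coord v (wedge G x p)) else 0))"
    using assms(1) by (intro sum.cong refl lookup_pt_mult[OF _ assms(2)]) blast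
  also have "\<dots> = (if p \<in> X then coord v p + \<alpha> / 2 * (\<Sum>y | collinear G p y. coord v y) else 0)
    + \<alpha> / 2 * (\<Sum>x | x \<in> X \<and> collinear G x p. coord v p - coord v (wedge G x p))"
    unfolding sum.distrib sum_distrib_left
    unfolding sum.inter_filter[OF fin] using fin by simp
  finally show ?thesis .
qed

lemma matsuo_mult_in_carrier:
  assumes "u \<in> matsuo_carrier G" "v \<in> matsuo_carrier G"
  shows "matsuo_mult \<alpha> G u v \<in> matsuo_carrier G"
proof -
  have "coord (point_mult \<alpha> G x y) p = 0" if "x \<in> points G" "y \<in> points G" "p \<notin> points G" for x y p
    using that collinear_wedge[of x y] collinear_points[of x "wedge G x y"]
    by (auto simp: point_mult_def lookup_add lookup_minus lookup_single when_def)
  then have "coord (matsuo_mult \<alpha> G u v) p = 0" if "p \<notin> points G" for p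
    using assms that unfolding matsuo_mult_def matsuo_carrier_def
    by (simp add: lookup_sum) (intro sum.neutral ballI, simp add: subset_iff)
  then show ?thesis
    by (auto simp: matsuo_carrier_def in_keys_iff)
qed

end

text \<open>The sets of points whose span has a multiple of the sum of all points as its identity.\<close>

locale regular_subsystem = triple_system G for G :: "'p geometry" +
  fixes X :: "'p set" and k :: nat
  assumes subset_points: "X \<subseteq> points G"
    and nonempty: "X \<noteq> {}"
    and wedge_closed: "\<lbrakk>x \<in> X; y \<in> X; collinear G x y\<rbrakk> \<Longrightarrow> wedge G x y \<in> X"
    and regular: "x \<in> X \<Longrightarrow> card {y. y \<in> X \<and> collinear G x y} = k"
begin

lemma finite_subsystem: "finite X"
  using subset_points finite_points finite_subset by blast

lemma point_sum_in_span: "point_sum X \<in> free.span (pt ` X)"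
  by (auto simp: span_pt_image keys_point_sum finite_subsystem)

text \<open>For \<open>p \<in> X\<close> the terms \<open>coord v y\<close> and \<open>coord v (p \<and> y)\<close> cancel in the sum over the neighbours \<open>y\<close> of \<open>p\<close>,
because \<open>y \<mapsto> p \<and> y\<close> permutes these neighbours.\<close>

lemma point_sum_mult:
  assumes "v \<in> free.span (pt ` X)"
  shows "matsuo_mult \<alpha> G (point_sum X) v = scale (1 + \<alpha> / 2 * of_nat k) v"
proof (rule poly_mapping_eqI)
  fix p
  have keys: "Poly_Mapping.keys v \<subseteq> X" using assms by (simp add: span_pt_image)
  then have zero: "coord v y = 0" if "y \<notin> X" for y using that by (auto simp: in_keys_iff)
  have car: "v \<in> matsuo_carrier G" using keys subset_points by (auto simp: matsuo_carrier_def)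
  let ?nb = "{y. y \<in> X \<and> collinear G p y}"
  have nb: "{x. x \<in> X \<and> collinear G x p} = ?nb"
    using collinear_sym[of G _ p] collinear_sym[of G p] by (intro Collect_cong) metis
  show "coord (matsuo_mult \<alpha> G (point_sum X) v) p = coord (scale (1 + \<alpha> / 2 * of_nat k) v) p"
  proof (cases "p \<in> X")
    case True
    have "(\<Sum>y | collinear G p y. coord v y) = (\<Sum>y\<in>?nb. coord v y)"
      using zero by (intro sum.mono_neutral_right finite_collinear) auto
    also have "\<dots> = (\<Sum>x\<in>?nb. coord v (wedge G x p))"
    proof (rule sum.reindex_bij_witness[of _ "\<lambda>x. wedge G x p" "\<lambda>x. wedge G p x"])
      fix y assume "y \<in> ?nb"
      then have y: "y \<in> X" "collinear G p y" by auto
      note w = collinear_wedge[OF y(2)] wedge_wedge[OF y(2)]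
      show "wedge G p y \<in> ?nb" using w y True wedge_closed by simp
      show "wedge G (wedge G p y) p = y" using w wedge_commute by metis
      then show "coord v (wedge G (wedge G p y) p) = coord v y" by simp
    next
      fix x assume "x \<in> ?nb"
      then have x: "x \<in> X" "collinear G p x" by auto
      have eq: "wedge G x p = wedge G p x" using wedge_commute[OF x(2)] by simp
      show "wedge G x p \<in> ?nb" "wedge G p (wedge G x p) = x"
        unfolding eq using x True wedge_closed collinear_wedge wedge_wedge by simp_all
    qed
    finally show ?thesis
      unfolding lookup_point_sum_mult[OF subset_points car] nb
      unfolding lookup_scale using True regular by (simp add: sum_subtractf algebra_simps)
  next
    case False
    have "coord v (wedge G x p) = 0" if "x \<in> X" "collinear G x p" for x
    proof (rule zero, rule)
      assume "wedge G x p \<in> X"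
      then have "wedge G x (wedge G x p) \<in> X" using that wedge_closed collinear_wedge by blast
      then show False using that wedge_wedge False by simp
    qed
    then show ?thesis
      unfolding lookup_point_sum_mult[OF subset_points car]
      using False zero by simp
  qed
qed

text \<open>The existence of an identity already excludes \<open>1 + \<alpha> / 2 * k = 0\<close>: otherwise the sum of \<open>X\<close> would
annihilate the identity and be zero.\<close>

lemma the_identity_eq:
  assumes "has_identity \<alpha> G (free.span (pt ` X))"
  shows "1 + \<alpha> / 2 * of_nat k \<noteq> 0"
    and "the_identity \<alpha> G (free.span (pt ` X)) = scale (1 / (1 + \<alpha> / 2 * of_nat k)) (point_sum X)"
proof -
  obtain u where u: "is_identity \<alpha> G (free.span (pt ` X)) u"
    using assms has_identity_def by blast
  have "point_sum X = matsuo_mult \<alpha> G (point_sum X) u"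
    using u point_sum_in_span unfolding is_identity_def by metis
  also have "\<dots> = scale (1 + \<alpha> / 2 * of_nat k) u"
    using u by (intro point_sum_mult) (simp add: is_identity_def)
  finally have eq: "point_sum X = scale (1 + \<alpha> / 2 * of_nat k) u" .
  have "Poly_Mapping.keys (point_sum X :: 'p \<Rightarrow>\<^sub>0 'a) \<noteq> {}"
    using nonempty by (simp add: keys_point_sum finite_subsystem)
  then show nz: "1 + \<alpha> / 2 * of_nat k \<noteq> 0"
    unfolding eq by (metis free.scale_zero_left keys_zero)
  have "u = scale (1 / (1 + \<alpha> / 2 * of_nat k)) (point_sum X)"
    unfolding eq using nz by (simp add: poly_mapping_eq_iff fun_eq_iff del: free.scale_left_distrib)
  then show "the_identity \<alpha> G (free.span (pt ` X)) = scale (1 / (1 + \<alpha> / 2 * of_nat k)) (point_sum X)"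
    using is_identity_unique[OF is_identity_the_identity[OF assms] u] by simp
qed

text \<open>Every point of \<open>X\<close> has the same form value \<open>2 c + c \<alpha> k\<close> with the sum of \<open>X\<close>.\<close>

lemma matsuo_form_point_sum:
  fixes \<alpha> c :: "'a::field"
  assumes "Y \<subseteq> X" "(2::'a::field) \<noteq> 0"
  shows "matsuo_form \<alpha> c G (point_sum X) (point_sum Y) = 2 * c * of_nat (card Y) * (1 + \<alpha> / 2 * of_nat k)"
    and "matsuo_form \<alpha> c G (point_sum Y) (point_sum X) = 2 * c * of_nat (card Y) * (1 + \<alpha> / 2 * of_nat k)"
proof -
  have sym: "point_form \<alpha> c G x y = point_form \<alpha> c G y x" for x y
    using collinear_sym[of G x y] collinear_sym[of G y x] by (auto simp: point_form_def)
  have fin: "finite Y" using assms(1) finite_subsystem finite_subset by blast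
  have row: "(\<Sum>y\<in>X. point_form \<alpha> c G x y) = 2 * c * (1 + \<alpha> / 2 * of_nat k)" if "x \<in> Y" for x
  proof -
    have "point_form \<alpha> c G x y = (if y = x then 2 * c else 0) + (if collinear G x y then c * \<alpha> else 0)" for y
      using collinear_points by (auto simp: point_form_def)
    then have "(\<Sum>y\<in>X. point_form \<alpha> c G x y) = 2 * c + c * \<alpha> * of_nat k"
      using that assms finite_subsystem regular[of x]
      by (auto simp: sum.distrib sum.inter_filter[symmetric])
    then show ?thesis using assms(2) by (simp add: field_simps)
  qed
  have "matsuo_form \<alpha> c G (point_sum Y) (point_sum X) = (\<Sum>x\<in>Y. \<Sum>y\<in>X. point_form \<alpha> c G x y)"
    by (simp add: matsuo_form_def keys_point_sum finite_subsystem fin lookup_point_sum)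
  also have "\<dots> = 2 * c * of_nat (card Y) * (1 + \<alpha> / 2 * of_nat k)"
    using row by simp
  finally show 1: "matsuo_form \<alpha> c G (point_sum Y) (point_sum X) = 2 * c * of_nat (card Y) * (1 + \<alpha> / 2 * of_nat k)" .
  have "matsuo_form \<alpha> c G (point_sum X) (point_sum Y) = (\<Sum>x\<in>X. \<Sum>y\<in>Y. point_form \<alpha> c G x y)"
    by (simp add: matsuo_form_def keys_point_sum finite_subsystem fin lookup_point_sum)
  also have "\<dots> = (\<Sum>x\<in>Y. \<Sum>y\<in>X. point_form \<alpha> c G x y)"
    by (subst sum.swap) (simp add: sym)
  also have "\<dots> = 2 * c * of_nat (card Y) * (1 + \<alpha> / 2 * of_nat k)"
    using row by simp
  finally show "matsuo_form \<alpha> c G (point_sum X) (point_sum Y) = 2 * c * of_nat (card Y) * (1 + \<alpha> / 2 * of_nat k)" .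
qed

end

section \<open>The Fischer space of the symmetric group and its double\<close>

lemma transpose_eq_transpose_iff:
  assumes "a \<noteq> b"
  shows "transpose a b = transpose c d \<longleftrightarrow> a = c \<and> b = d \<or> a = d \<and> b = c"
  using assms by (metis transpose_apply_first transpose_apply_other transpose_commute transpose_eq_id_iff)

abbreviation letters :: "nat \<Rightarrow> nat set" where
  "letters j \<equiv> {1..j + 1}"

lemma points_fischer_A:
  "x \<in> points (fischer_A j) \<longleftrightarrow> (\<exists>a\<in>letters j. \<exists>b\<in>letters j. a \<noteq> b \<and> x = transpose a b)"
  unfolding fischer_A_def by (simp only: geometry.simps mem_Collect_eq) metis

lemma transpose_in_points_iff:
  "transpose a b \<in> points (fischer_A j) \<longleftrightarrow> a \<in> letters j \<and> b \<in> letters j \<and> a \<noteq> b"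
proof
  assume "transpose a b \<in> points (fischer_A j)"
  then obtain c d where "c \<in> letters j" "d \<in> letters j" "c \<noteq> d" "transpose c d = transpose a b"
    using points_fischer_A by metis
  then show "a \<in> letters j \<and> b \<in> letters j \<and> a \<noteq> b"
    using transpose_eq_transpose_iff[of c d a b] by auto
next
  assume "a \<in> letters j \<and> b \<in> letters j \<and> a \<noteq> b"
  then show "transpose a b \<in> points (fischer_A j)" using points_fischer_A by blast
qed

lemma finite_points_fischer_A: "finite (points (fischer_A j))"
proof (rule finite_subset)
  show "points (fischer_A j) \<subseteq> (\<lambda>(a, b). transpose a b) ` (letters j \<times> letters j)"
    by (auto simp: points_fischer_A)
qed simp

lemma lines_fischer_A:
  "l \<in> lines (fischer_A j) \<longleftrightarrow> (\<exists>a b d. {a, b, d} \<subseteq> letters j \<and> a \<noteq> b \<and> b \<noteq> d \<and> a \<noteq> d \<and>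
     l = {transpose a b, transpose b d, transpose a d})"
  by (auto simp: fischer_A_def)

lemma fischer_A_lineE:
  assumes "l \<in> lines (fischer_A j)" "x \<in> l" "y \<in> l" "x \<noteq> y"
  obtains a b d where "a \<in> letters j" "b \<in> letters j" "d \<in> letters j" "a \<noteq> b" "b \<noteq> d" "a \<noteq> d"
    "x = transpose a b" "y = transpose b d" "l = {transpose a b, transpose b d, transpose a d}"
proof -
  from assms(1) obtain a b d where abd: "{a, b, d} \<subseteq> letters j" "a \<noteq> b" "b \<noteq> d" "a \<noteq> d"
    and l: "l = {transpose a b, transpose b d, transpose a d}"
    unfolding lines_fischer_A by blast
  have mem: "x = transpose a b \<or> x = transpose b d \<or> x = transpose a d"
    "y = transpose a b \<or> y = transpose b d \<or> y = transpose a d"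
    using assms(2,3) l by auto
  have L: "a \<in> letters j" "b \<in> letters j" "d \<in> letters j" using abd(1) by auto
  consider "x = transpose a b" "y = transpose b d" | "x = transpose b a" "y = transpose a d"
    | "x = transpose d b" "y = transpose b a" | "x = transpose b d" "y = transpose d a"
    | "x = transpose d a" "y = transpose a b" | "x = transpose a d" "y = transpose d b"
    using mem assms(4) by (metis transpose_commute)
  then show thesis
  proof cases
    case 1
    show thesis by (rule that[OF L abd(2-4) 1 l])
  next
    case 2
    show thesis
      by (rule that[OF L(2,1,3) _ _ _ 2]) (use abd l in \<open>auto simp: transpose_commute\<close>)
  next
    case 3
    show thesis
      by (rule that[OF L(3,2,1) _ _ _ 3]) (use abd l in \<open>auto simp: transpose_commute\<close>)
  next
    case 4
    show thesis
      by (rule that[OF L(2,3,1) _ _ _ 4]) (use abd l in \<open>auto simp: transpose_commute\<close>)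
  next
    case 5
    show thesis
      by (rule that[OF L(3,1,2) _ _ _ 5]) (use abd l in \<open>auto simp: transpose_commute\<close>)
  next
    case 6
    show thesis
      by (rule that[OF L(1,3,2) _ _ _ 6]) (use abd l in \<open>auto simp: transpose_commute\<close>)
  qed
qed

lemma collinear_fischer_A_iff:
  "collinear (fischer_A j) x y \<longleftrightarrow> (\<exists>a\<in>letters j. \<exists>b\<in>letters j. \<exists>d\<in>letters j.
     a \<noteq> b \<and> b \<noteq> d \<and> a \<noteq> d \<and> x = transpose a b \<and> y = transpose b d)"
proof
  assume "collinear (fischer_A j) x y"
  then show "\<exists>a\<in>letters j. \<exists>b\<in>letters j. \<exists>d\<in>letters j.
     a \<noteq> b \<and> b \<noteq> d \<and> a \<noteq> d \<and> x = transpose a b \<and> y = transpose b d"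
    unfolding collinear_def using fischer_A_lineE by metis
next
  assume "\<exists>a\<in>letters j. \<exists>b\<in>letters j. \<exists>d\<in>letters j.
     a \<noteq> b \<and> b \<noteq> d \<and> a \<noteq> d \<and> x = transpose a b \<and> y = transpose b d"
  then obtain a b d where abd: "{a, b, d} \<subseteq> letters j" "a \<noteq> b" "b \<noteq> d" "a \<noteq> d"
    and xy: "x = transpose a b" "y = transpose b d" by blast
  have "{transpose a b, transpose b d, transpose a d} \<in> lines (fischer_A j)"
    unfolding lines_fischer_A using abd by blast
  then show "collinear (fischer_A j) x y"
    unfolding collinear_def xy using abd by (auto simp: transpose_in_points_iff transpose_eq_transpose_iff)
qed

lemma collinear_fischer_AI:
  assumes "a \<in> letters j" "b \<in> letters j" "d \<in> letters j" "a \<noteq> b" "b \<noteq> d" "a \<noteq> d"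
  shows "collinear (fischer_A j) (transpose a b) (transpose b d)"
  unfolding collinear_fischer_A_iff using assms by metis

lemma wedge_fischer_A:
  assumes "a \<in> letters j" "b \<in> letters j" "d \<in> letters j" "a \<noteq> b" "b \<noteq> d" "a \<noteq> d"
  shows "wedge (fischer_A j) (transpose a b) (transpose b d) = transpose a d"
  unfolding wedge_def
proof (rule the_equality, intro conjI)
  show "transpose a d \<noteq> transpose a b" "transpose a d \<noteq> transpose b d"
    using assms by (auto simp: transpose_eq_transpose_iff)
  show "{transpose a b, transpose b d, transpose a d} \<in> lines (fischer_A j)"
    unfolding lines_fischer_A using assms by blast
next
  fix z assume z: "z \<noteq> transpose a b \<and> z \<noteq> transpose b d \<and>
    {transpose a b, transpose b d, z} \<in> lines (fischer_A j)"
  have "transpose a b \<noteq> transpose b d" using assms by (auto simp: transpose_eq_transpose_iff)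
  moreover have "{transpose a b, transpose b d, z} \<in> lines (fischer_A j)" using z by blast
  ultimately obtain p q r where "transpose a b = transpose p q" "transpose b d = transpose q r"
    and eq: "{transpose a b, transpose b d, z} = {transpose p q, transpose q r, transpose p r}"
    using fischer_A_lineE[of "{transpose a b, transpose b d, z}" j "transpose a b" "transpose b d"]
    by (metis insertCI)
  then have "p = a" "q = b" "r = d" using assms by (auto simp: transpose_eq_transpose_iff)
  then show "z = transpose a d" using z eq by blast
qed

lemma triple_system_fischer_A: "triple_system (fischer_A j)"
proof
  show "finite (points (fischer_A j))" by (rule finite_points_fischer_A)
next
  fix x y assume "collinear (fischer_A j) x y"
  then obtain a b d where abd: "a \<in> letters j" "b \<in> letters j" "d \<in> letters j" "a \<noteq> b" "b \<noteq> d" "a \<noteq> d"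
    and xy: "x = transpose a b" "y = transpose b d"
    unfolding collinear_fischer_A_iff by blast
  have w: "wedge (fischer_A j) x y = transpose a d"
    unfolding xy by (rule wedge_fischer_A[OF abd])
  show "wedge (fischer_A j) x y = wedge (fischer_A j) y x"
    using wedge_fischer_A[of d j b a] abd unfolding w unfolding xy by (metis transpose_commute)
  show "collinear (fischer_A j) x (wedge (fischer_A j) x y)"
    unfolding w collinear_fischer_A_iff using abd xy by (metis transpose_commute)
  show "wedge (fischer_A j) x (wedge (fischer_A j) x y) = y"
    unfolding w using wedge_fischer_A[of b j a d] abd unfolding xy by (metis transpose_commute)
qed

lemma sign_mult_cancel: "sign_mult s (sign_mult s t) = t"
  by (cases s; cases t; simp)

lemma sign_mult_commute: "sign_mult s t = sign_mult t s"
  by (cases s; cases t; simp)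

lemma sign_UNIV: "UNIV = {Pos, Neg}"
  using sign.exhaust by blast

context triple_system
begin

lemma collinear_pairs:
  assumes "collinear G x y"
  shows "collinear G y (wedge G x y)" "wedge G y (wedge G x y) = x"
   "wedge G (wedge G x y) x = y" "wedge G (wedge G x y) y = x"
  using assms wedge_commute collinear_wedge wedge_wedge collinear_sym by metis+

text \<open>The three points of a line of the double are interchangeable: each sign is the product of the other two.\<close>

lemma double_line_closed:
  assumes "collinear G a b" "l = {(a, s), (b, t), (wedge G a b, sign_mult s t)}"
    "(x, e) \<in> l" "(y, f) \<in> l" "(x, e) \<noteq> (y, f)"
  shows "collinear G x y \<and> l = {(x, e), (y, f), (wedge G x y, sign_mult e f)}"
proof -
  let ?d = "wedge G a b"
  have col: "collinear G a b" "collinear G b a" "collinear G a ?d" "collinear G ?d a"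
    "collinear G b ?d" "collinear G ?d b"
    using assms(1) collinear_wedge collinear_pairs(1) collinear_sym by metis+
  have w: "wedge G b a = ?d" "wedge G a ?d = b" "wedge G ?d a = b" "wedge G b ?d = a" "wedge G ?d b = a"
    using assms(1) wedge_commute wedge_wedge collinear_pairs by metis+
  have sg: "sign_mult s (sign_mult s t) = t" "sign_mult t s = sign_mult s t"
    "sign_mult (sign_mult s t) s = t" "sign_mult t (sign_mult s t) = s" "sign_mult (sign_mult s t) t = s"
    by (cases s; cases t; simp)+
  have "(x, e) = (a, s) \<or> (x, e) = (b, t) \<or> (x, e) = (?d, sign_mult s t)"
    "(y, f) = (a, s) \<or> (y, f) = (b, t) \<or> (y, f) = (?d, sign_mult s t)"
    using assms(2-4) by auto
  then show ?thesis
    unfolding assms(2) using assms(5) col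
    by (elim disjE) (simp_all only: prod.inject w sg insert_commute simp_thms)
qed

lemma double_lineE:
  assumes "l \<in> lines (double_graph G)" "(x, e) \<in> l" "(y, f) \<in> l" "(x, e) \<noteq> (y, f)"
  shows "collinear G x y \<and> l = {(x, e), (y, f), (wedge G x y, sign_mult e f)}"
proof -
  obtain a s b t where "collinear G a b" "l = {(a, s), (b, t), (wedge G a b, sign_mult s t)}"
    using assms(1) unfolding double_graph_def by auto
  then show ?thesis using double_line_closed[OF _ _ assms(2-4)] by simp
qed

lemma collinear_double_iff:
  "collinear (double_graph G) (x, s) (y, t) \<longleftrightarrow> collinear G x y"
proof
  assume "collinear (double_graph G) (x, s) (y, t)"
  then show "collinear G x y"
    unfolding collinear_def[of "double_graph G"] using double_lineE by blast
next
  assume *: "collinear G x y"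
  then show "collinear (double_graph G) (x, s) (y, t)"
    unfolding collinear_def[of "double_graph G"]
    unfolding double_graph_def using collinear_points[OF *] by simp blast
qed

lemma wedge_double:
  assumes "collinear G x y"
  shows "wedge (double_graph G) (x, s) (y, t) = (wedge G x y, sign_mult s t)"
  unfolding wedge_def[of "double_graph G"]
proof (rule the_equality, intro conjI)
  have "wedge G x y \<noteq> x" "wedge G x y \<noteq> y"
    using collinear_points[OF collinear_wedge[OF assms]] collinear_points[OF collinear_pairs(1)[OF assms]]
    by metis+
  then show "(wedge G x y, sign_mult s t) \<noteq> (x, s)" "(wedge G x y, sign_mult s t) \<noteq> (y, t)" by auto
  show "{(x, s), (y, t), (wedge G x y, sign_mult s t)} \<in> lines (double_graph G)"
    using assms by (auto simp: double_graph_def)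
next
  fix z assume z: "z \<noteq> (x, s) \<and> z \<noteq> (y, t) \<and> {(x, s), (y, t), z} \<in> lines (double_graph G)"
  have "(x, s) \<noteq> (y, t)" using collinear_points[OF assms] by simp
  then have "{(x, s), (y, t), z} = {(x, s), (y, t), (wedge G x y, sign_mult s t)}"
    using z double_lineE[of "{(x, s), (y, t), z}" x s y t] by blast
  then show "z = (wedge G x y, sign_mult s t)" using z by blast
qed

lemma triple_system_double: "triple_system (double_graph G)"
proof
  show "finite (points (double_graph G))"
    using finite_points by (simp add: double_graph_def sign_UNIV)
next
  fix p q assume "collinear (double_graph G) p q"
  moreover obtain x s y t where pq: "p = (x, s)" "q = (y, t)" by fastforce
  ultimately have xy: "collinear G x y" by (simp add: collinear_double_iff)
  note w = wedge_double[OF xy] wedge_double[OF collinear_sym[OF xy]] wedge_double[OF collinear_wedge[OF xy]]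
  show "wedge (double_graph G) p q = wedge (double_graph G) q p"
    unfolding pq w using wedge_commute[OF xy] sign_mult_commute by simp
  show "collinear (double_graph G) p (wedge (double_graph G) p q)"
    unfolding pq w collinear_double_iff by (rule collinear_wedge[OF xy])
  show "wedge (double_graph G) p (wedge (double_graph G) p q) = q"
    unfolding pq w using wedge_wedge[OF xy] sign_mult_cancel by simp
qed

end

abbreviation double_A :: "nat \<Rightarrow> ((nat \<Rightarrow> nat) \<times> sign) geometry" where
  "double_A n \<equiv> double_graph (fischer_A n)"

lemmas triple_system_double_A = triple_system.triple_system_double[OF triple_system_fischer_A]

lemma points_double_A: "(x, s) \<in> points (double_A n) \<longleftrightarrow> x \<in> points (fischer_A n)"
  by (simp add: double_graph_def)

lemma points_double_A_eq: "points (double_A n) = points (fischer_A n) \<times> UNIV"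
  by (simp add: double_graph_def)

lemma collinear_double_A: "collinear (double_A n) (x, s) (y, t) \<longleftrightarrow> collinear (fischer_A n) x y"
  by (rule triple_system.collinear_double_iff[OF triple_system_fischer_A])

lemma wedge_double_A:
  assumes "a \<in> letters n" "b \<in> letters n" "d \<in> letters n" "a \<noteq> b" "b \<noteq> d" "a \<noteq> d"
  shows "wedge (double_A n) (transpose a d, t) (transpose a b, s) = (transpose b d, sign_mult t s)"
proof -
  have "collinear (fischer_A n) (transpose a d) (transpose a b)"
    unfolding collinear_fischer_A_iff using assms by (metis transpose_commute)
  moreover have "wedge (fischer_A n) (transpose a d) (transpose a b) = transpose b d"
    using wedge_fischer_A[of d n a b] assms by (metis transpose_commute)
  ultimately show ?thesis
    using triple_system.wedge_double[OF triple_system_fischer_A] by simp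
qed

text \<open>The neighbours of the edge \<open>{a, b}\<close> are the edges that share exactly one end with it.\<close>

lemma sum_collinear_transpose:
  fixes F :: "(nat \<Rightarrow> nat) \<Rightarrow> 'b::comm_monoid_add"
  assumes ab: "a \<in> letters n" "b \<in> letters n" "a \<noteq> b" and jn: "j \<le> n"
  shows "(\<Sum>x | x \<in> points (fischer_A j) \<and> collinear (fischer_A n) (transpose a b) x. F x) =
    (if a \<in> letters j then \<Sum>d\<in>letters j - {a, b}. F (transpose a d) else 0) +
    (if b \<in> letters j then \<Sum>d\<in>letters j - {a, b}. F (transpose b d) else 0)"
proof -
  define A where "A = (if a \<in> letters j then transpose a ` (letters j - {a, b}) else {})"
  define B where "B = (if b \<in> letters j then transpose b ` (letters j - {a, b}) else {})"
  have sub: "letters j \<subseteq> letters n" using jn by auto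
  have branch: "P \<and> (\<exists>d\<in>S. x = f d)" if "x \<in> (if P then f ` S else {})" for P S x and f :: "nat \<Rightarrow> nat \<Rightarrow> nat"
    using that by (auto split: if_splits)
  have mem: "x \<in> points (fischer_A j) \<and> collinear (fischer_A n) (transpose a b) x \<longleftrightarrow> x \<in> A \<union> B" for x
  proof
    assume x: "x \<in> points (fischer_A j) \<and> collinear (fischer_A n) (transpose a b) x"
    then obtain p q r where pqr: "p \<noteq> q" "q \<noteq> r" "p \<noteq> r" "transpose a b = transpose p q" "x = transpose q r"
      unfolding collinear_fischer_A_iff by blast
    moreover have "q \<in> letters j" "r \<in> letters j"
      using x pqr(5) transpose_in_points_iff by auto
    moreover have "(b = q \<and> a = p) \<or> (a = q \<and> b = p)"
      using pqr(4) transpose_eq_transpose_iff[OF ab(3), of p q] by blast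
    ultimately show "x \<in> A \<union> B"
      unfolding A_def B_def by (elim disjE conjE) simp_all
  next
    assume "x \<in> A \<union> B"
    then have "(a \<in> letters j \<and> (\<exists>d\<in>letters j - {a, b}. x = transpose a d)) \<or>
        (b \<in> letters j \<and> (\<exists>d\<in>letters j - {a, b}. x = transpose b d))"
      unfolding A_def B_def Un_iff by (elim disj_forward) (erule branch)+
    then obtain c d where "c = a \<or> c = b" "c \<in> letters j" "d \<in> letters j - {a, b}" "x = transpose c d"
      by blast
    then have cd: "x = transpose c d" "c = a \<or> c = b" "c \<in> letters j" "d \<in> letters j" "d \<noteq> a" "d \<noteq> b"
      by blast+
    then have "x \<in> points (fischer_A j)" unfolding cd(1) transpose_in_points_iff by blast
    moreover have "collinear (fischer_A n) (transpose a b) x"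
    proof -
      have d: "d \<in> letters n" "a \<noteq> d" "b \<noteq> d" using cd sub by blast+
      from cd(2) show ?thesis
      proof
        assume "c = a"
        then show ?thesis
          using collinear_fischer_AI[OF ab(2,1) d(1) not_sym[OF ab(3)] d(2,3)] cd(1)
          by (simp add: transpose_commute)
      next
        assume "c = b"
        then show ?thesis
          using collinear_fischer_AI[OF ab(1,2) d(1) ab(3) d(3,2)] cd(1) by simp
      qed
    qed
    ultimately show "x \<in> points (fischer_A j) \<and> collinear (fischer_A n) (transpose a b) x" by blast
  qed
  have inj: "inj_on (transpose c) (letters j - {a, b})" if "c = a \<or> c = b" for c
    using that by (intro inj_onI) (auto simp: transpose_eq_transpose_iff)
  have "A \<inter> B = {}"
    unfolding A_def B_def using ab(3) by (auto simp: transpose_eq_transpose_iff)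
  moreover have "finite A" "finite B" by (auto simp: A_def B_def)
  ultimately have "(\<Sum>x\<in>A \<union> B. F x) = sum F A + sum F B" by (rule sum.union_disjoint[rotated 2])
  moreover have "sum F A = (if a \<in> letters j then \<Sum>d\<in>letters j - {a, b}. F (transpose a d) else 0)"
    unfolding A_def using inj[of a] by (simp add: sum.reindex)
  moreover have "sum F B = (if b \<in> letters j then \<Sum>d\<in>letters j - {a, b}. F (transpose b d) else 0)"
    unfolding B_def using inj[of b] by (simp add: sum.reindex)
  ultimately show ?thesis by (simp only: mem Collect_mem_eq)
qed

lemma card_collinear_transpose:
  assumes "x \<in> points (fischer_A j)" "j \<le> n"
  shows "card {y \<in> points (fischer_A j). collinear (fischer_A n) x y} = 2 * (j - 1)"
proof -
  obtain a b where ab: "a \<in> letters j" "b \<in> letters j" "a \<noteq> b" "x = transpose a b"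
    using assms(1) points_fischer_A by blast
  have "card (letters j - {a, b}) = j - 1" using ab by (simp add: card_Diff_subset)
  moreover have "a \<in> letters n" "b \<in> letters n" using ab assms(2) by auto
  ultimately show ?thesis
    using sum_collinear_transpose[of a n b j "\<lambda>_. 1::nat"] ab assms(2) by (simp add: card_eq_sum[symmetric])
qed

lemma card_points_fischer_A: "2 * card (points (fischer_A j)) = j * (j + 1)"
proof (induction j)
  case 0
  have "points (fischer_A 0) = {}" by (auto simp: points_fischer_A)
  then show ?case by simp
next
  case (Suc j)
  have eq: "points (fischer_A (Suc j)) = points (fischer_A j) \<union> transpose (Suc j + 1) ` letters j"
  proof (intro set_eqI iffI)
    fix x assume "x \<in> points (fischer_A (Suc j))"
    then obtain a b where ab: "a \<in> letters (Suc j)" "b \<in> letters (Suc j)" "a \<noteq> b" "x = transpose a b"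
      using points_fischer_A by blast
    then consider "a \<in> letters j" "b \<in> letters j" | "a = Suc j + 1" "b \<in> letters j" | "b = Suc j + 1" "a \<in> letters j"
      by fastforce
    then show "x \<in> points (fischer_A j) \<union> transpose (Suc j + 1) ` letters j"
      using ab by cases (auto simp: transpose_in_points_iff transpose_commute[of _ "Suc (Suc j)"])
  next
    fix x assume "x \<in> points (fischer_A j) \<union> transpose (Suc j + 1) ` letters j"
    then show "x \<in> points (fischer_A (Suc j))"
      by (auto simp: points_fischer_A[of _ j] transpose_in_points_iff)
  qed
  have "inj_on (transpose (Suc j + 1)) (letters j)"
    by (intro inj_onI) (auto simp: transpose_eq_transpose_iff)
  then have "card (transpose (Suc j + 1) ` letters j) = j + 1" by (simp add: card_image)
  moreover have "points (fischer_A j) \<inter> transpose (Suc j + 1) ` letters j = {}"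
    by (auto simp: transpose_in_points_iff)
  ultimately have "card (points (fischer_A (Suc j))) = card (points (fischer_A j)) + (j + 1)"
    unfolding eq using finite_points_fischer_A by (subst card_Un_disjoint) auto
  then show ?case using Suc by simp
qed

definition plus_points :: "nat \<Rightarrow> ((nat \<Rightarrow> nat) \<times> sign) set" where
  "plus_points j = points (fischer_A j) \<times> {Pos}"

lemma finite_plus_points: "finite (plus_points j)"
  by (simp add: plus_points_def finite_points_fischer_A)

lemma sub_A_eq_span: "sub_A j = free.span (pt ` plus_points j)"
  unfolding sub_A_def plus_points_def by (rule arg_cong[of _ _ free.span]) auto

lemma points_fischer_A_mono: "j \<le> n \<Longrightarrow> points (fischer_A j) \<subseteq> points (fischer_A n)"
  by (auto simp: points_fischer_A[of _ j] transpose_in_points_iff)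

lemma points_fischer_A_nonempty: "1 \<le> j \<Longrightarrow> points (fischer_A j) \<noteq> {}"
  using transpose_in_points_iff[of 1 2 j] by auto

lemma wedge_in_subsystem:
  assumes "collinear (fischer_A n) x y" "x \<in> points (fischer_A j)" "y \<in> points (fischer_A j)"
  shows "wedge (fischer_A n) x y \<in> points (fischer_A j)"
proof -
  obtain a b d where abd: "a \<in> letters n" "b \<in> letters n" "d \<in> letters n" "a \<noteq> b" "b \<noteq> d" "a \<noteq> d"
    "x = transpose a b" "y = transpose b d"
    using assms(1) unfolding collinear_fischer_A_iff by blast
  then show ?thesis
    using wedge_fischer_A[OF abd(1-6)] assms(2,3) transpose_in_points_iff by auto
qed

lemma regular_plus_points:
  assumes "1 \<le> j" "j \<le> n"
  shows "regular_subsystem (double_A n) (plus_points j) (2 * (j - 1))"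
proof (rule regular_subsystem.intro[OF triple_system_double_A], unfold_locales)
  show "plus_points j \<subseteq> points (double_A n)"
    using points_fischer_A_mono[OF assms(2)] by (auto simp: plus_points_def points_double_A)
  show "plus_points j \<noteq> {}"
    using points_fischer_A_nonempty[OF assms(1)] by (simp add: plus_points_def)
next
  fix p q assume pq: "p \<in> plus_points j" "q \<in> plus_points j" "collinear (double_A n) p q"
  then obtain x y where "p = (x, Pos)" "q = (y, Pos)" "x \<in> points (fischer_A j)" "y \<in> points (fischer_A j)"
    by (auto simp: plus_points_def)
  then show "wedge (double_A n) p q \<in> plus_points j"
    using pq(3) wedge_in_subsystem[of n x y j] triple_system.wedge_double[OF triple_system_fischer_A, of n x y]
    by (simp add: collinear_double_A plus_points_def)
next
  fix p assume "p \<in> plus_points j"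
  then obtain x where x: "p = (x, Pos)" "x \<in> points (fischer_A j)" by (auto simp: plus_points_def)
  have "{q \<in> plus_points j. collinear (double_A n) p q} =
      {y \<in> points (fischer_A j). collinear (fischer_A n) x y} \<times> {Pos}"
    unfolding x(1) plus_points_def by (auto simp: collinear_double_A)
  then show "card {q \<in> plus_points j. collinear (double_A n) p q} = 2 * (j - 1)"
    using card_collinear_transpose[OF x(2) assms(2)] by (simp add: card_cartesian_product)
qed

lemma regular_double_points:
  assumes "1 \<le> j" "j \<le> n"
  shows "regular_subsystem (double_A n) (points (double_A j)) (4 * (j - 1))"
proof (rule regular_subsystem.intro[OF triple_system_double_A], unfold_locales)
  show "points (double_A j) \<subseteq> points (double_A n)"
    using points_fischer_A_mono[OF assms(2)] by (auto simp: points_double_A)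
  show "points (double_A j) \<noteq> {}"
    using points_fischer_A_nonempty[OF assms(1)] by (auto simp: points_double_A_eq)
next
  fix p q assume pq: "p \<in> points (double_A j)" "q \<in> points (double_A j)" "collinear (double_A n) p q"
  obtain x s y t where "p = (x, s)" "q = (y, t)" by fastforce
  then show "wedge (double_A n) p q \<in> points (double_A j)"
    using pq wedge_in_subsystem[of n x y j] triple_system.wedge_double[OF triple_system_fischer_A, of n x y]
    by (simp add: collinear_double_A points_double_A)
next
  fix p assume p: "p \<in> points (double_A j)"
  obtain x s where x: "p = (x, s)" by fastforce
  have "{q \<in> points (double_A j). collinear (double_A n) p q} =
      {y \<in> points (fischer_A j). collinear (fischer_A n) x y} \<times> {Pos, Neg}"
    unfolding x points_double_A_eq sign_UNIV by (auto simp: collinear_double_A)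
  then show "card {q \<in> points (double_A j). collinear (double_A n) p q} = 4 * (j - 1)"
    using card_collinear_transpose[of x j n] assms p x by (simp add: card_cartesian_product points_double_A)
qed

section \<open>Multiplication by the sum of the positive points in coordinates\<close>

definition row_sum :: "((nat \<Rightarrow> nat) \<times> sign \<Rightarrow>\<^sub>0 'a::field) \<Rightarrow> sign \<Rightarrow> nat set \<Rightarrow> nat \<Rightarrow> 'a" where
  "row_sum v s K a = (\<Sum>d\<in>K. coord v (transpose a d, s))"

lemma coord_transpose_self:
  assumes "v \<in> matsuo_carrier (double_A n)"
  shows "coord v (transpose a a, s) = 0"
proof -
  have "(transpose a a, s) \<notin> points (double_A n)"
    by (simp only: points_double_A transpose_in_points_iff) simp
  then show ?thesis using assms by (auto simp: matsuo_carrier_def in_keys_iff simp del: transpose_same)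
qed

lemma sum_Diff_pair:
  fixes f :: "nat \<Rightarrow> 'a::ab_group_add"
  assumes "finite K" "a \<noteq> b"
  shows "sum f (K - {a, b}) = sum f K - (if a \<in> K then f a else 0) - (if b \<in> K then f b else 0)"
proof -
  have "sum f (K - {a, b}) = sum f (K - {a} - {b})" by (simp add: Diff_insert2[symmetric])
  then show ?thesis using assms by (simp add: sum_diff1)
qed

lemma sum_row_Diff:
  assumes "v \<in> matsuo_carrier (double_A n)" "finite K" "a \<noteq> b"
  shows "(\<Sum>d\<in>K - {a, b}. coord v (transpose a d, s)) =
      row_sum v s K a - (if b \<in> K then coord v (transpose a b, s) else 0)"
    "(\<Sum>d\<in>K - {a, b}. coord v (transpose b d, s)) =
      row_sum v s K b - (if a \<in> K then coord v (transpose a b, s) else 0)"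
  using sum_Diff_pair[OF assms(2,3), of "\<lambda>d. coord v (transpose a d, s)"]
    sum_Diff_pair[OF assms(2,3), of "\<lambda>d. coord v (transpose b d, s)"]
    coord_transpose_self[OF assms(1)] transpose_commute[of b a]
  by (simp_all add: row_sum_def del: transpose_same)

lemma sum_collinear_double:
  assumes "v \<in> matsuo_carrier (double_A n)" "a \<in> letters n" "b \<in> letters n" "a \<noteq> b"
  shows "(\<Sum>y | collinear (double_A n) (transpose a b, s) y. coord v y) =
    row_sum v Pos (letters n) a + row_sum v Neg (letters n) a
    + row_sum v Pos (letters n) b + row_sum v Neg (letters n) b
    - 2 * coord v (transpose a b, Pos) - 2 * coord v (transpose a b, Neg)"
proof -
  let ?N = "{x. x \<in> points (fischer_A n) \<and> collinear (fischer_A n) (transpose a b) x}"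
  have "{y. collinear (double_A n) (transpose a b, s) y} = ?N \<times> {Pos, Neg}"
  proof (intro set_eqI)
    fix q :: "(nat \<Rightarrow> nat) \<times> sign"
    obtain x t where q: "q = (x, t)" by fastforce
    have "x \<in> points (fischer_A n)" if "collinear (fischer_A n) (transpose a b) x"
      using that by (simp add: collinear_def)
    then show "q \<in> {y. collinear (double_A n) (transpose a b, s) y} \<longleftrightarrow> q \<in> ?N \<times> {Pos, Neg}"
      unfolding q mem_Collect_eq mem_Times_iff collinear_double_A sign_UNIV[symmetric] by auto
  qed
  then have "(\<Sum>y | collinear (double_A n) (transpose a b, s) y. coord v y) =
      (\<Sum>x\<in>?N. \<Sum>t\<in>{Pos, Neg}. coord v (x, t))"
    by (simp only: sum.cartesian_product) simp
  also have "\<dots> = (\<Sum>x\<in>?N. coord v (x, Pos)) + (\<Sum>x\<in>?N. coord v (x, Neg))"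
    by (simp add: sum.distrib)
  finally show ?thesis
    unfolding sum_collinear_transpose[OF assms(2,3,4) order.refl]
    using assms(2,3) by (simp add: sum_row_Diff[OF assms(1) _ assms(4)])
qed

lemma sum_wedge_double:
  assumes "v \<in> matsuo_carrier (double_A n)" "a \<in> letters n" "b \<in> letters n" "a \<noteq> b" "j \<le> n"
  shows "(\<Sum>x | x \<in> plus_points j \<and> collinear (double_A n) x (transpose a b, s).
      coord v (transpose a b, s) - coord v (wedge (double_A n) x (transpose a b, s))) =
    (if a \<in> letters j then \<Sum>d\<in>letters j - {a, b}. coord v (transpose a b, s) - coord v (transpose b d, s) else 0)
    + (if b \<in> letters j then \<Sum>d\<in>letters j - {a, b}. coord v (transpose a b, s) - coord v (transpose a d, s) else 0)"
proof -
  let ?N = "{x. x \<in> points (fischer_A j) \<and> collinear (fischer_A n) (transpose a b) x}"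
  let ?F = "\<lambda>x. coord v (transpose a b, s) - coord v (wedge (double_A n) (x, Pos) (transpose a b, s))"
  have "{x. x \<in> plus_points j \<and> collinear (double_A n) x (transpose a b, s)} = (\<lambda>x. (x, Pos)) ` ?N"
    using collinear_sym[of "fischer_A n" _ "transpose a b"] collinear_sym[of "fischer_A n" "transpose a b"]
    by (auto simp: plus_points_def collinear_double_A)
  then have eq: "(\<Sum>x | x \<in> plus_points j \<and> collinear (double_A n) x (transpose a b, s).
      coord v (transpose a b, s) - coord v (wedge (double_A n) x (transpose a b, s))) = (\<Sum>x\<in>?N. ?F x)"
    by (simp add: sum.reindex inj_on_def)
  have sub: "letters j \<subseteq> letters n" using assms(5) by auto
  have wa: "?F (transpose a d) = coord v (transpose a b, s) - coord v (transpose b d, s)"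
    if "d \<in> letters j - {a, b}" for d
    using that sub assms wedge_double_A[of a n b d Pos s] by auto
  have wb: "?F (transpose b d) = coord v (transpose a b, s) - coord v (transpose a d, s)"
    if "d \<in> letters j - {a, b}" for d
    using that sub assms wedge_double_A[of b n a d Pos s] transpose_commute[of a b] by auto
  show ?thesis
    unfolding eq sum_collinear_transpose[OF assms(2-5)]
    by (intro arg_cong2[of _ _ _ _ "(+)"] if_cong sum.cong refl wa wb)
qed

text \<open>The formula \<open>lookup_point_sum_mult\<close> for an edge with both ends in \<open>\<A>\<^sub>j\<close>: each letter \<open>d\<close> contributes the
differences of the weight of \<open>{a, b}\<close> with those of \<open>{b, d}\<close> and \<open>{a, d}\<close>, which add up to row sums.
The extra term for the positive sign arises because the edge is then itself a summand of \<open>S\<^sub>j\<close>, and it collects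
all neighbours in the ambient geometry.\<close>

lemma coord_mult_inside:
  fixes v :: "(nat \<Rightarrow> nat) \<times> sign \<Rightarrow>\<^sub>0 'a::field"
  assumes two: "(2::'a) \<noteq> 0" and v: "v \<in> matsuo_carrier (double_A n)" and jn: "j \<le> n"
    and ab: "a \<in> letters j" "b \<in> letters j" "a \<noteq> b"
  shows "coord (matsuo_mult \<alpha> (double_A n) (point_sum (plus_points j)) v) (transpose a b, s) =
    \<alpha> * of_nat j * coord v (transpose a b, s)
    - \<alpha> / 2 * (row_sum v s (letters j) a + row_sum v s (letters j) b)
    + (if s = Pos then (1 - \<alpha>) * coord v (transpose a b, Pos) - \<alpha> * coord v (transpose a b, Neg)
         + \<alpha> / 2 * (row_sum v Pos (letters n) a + row_sum v Neg (letters n) a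
           + row_sum v Pos (letters n) b + row_sum v Neg (letters n) b) else 0)"
proof -
  have sub: "plus_points j \<subseteq> points (double_A n)"
    using points_fischer_A_mono[OF jn] by (auto simp: plus_points_def points_double_A)
  have abn: "a \<in> letters n" "b \<in> letters n" using ab jn by auto
  have "1 \<le> j" using ab by auto
  moreover have "card (letters j - {a, b}) = j - 1" using ab by (simp add: card_Diff_subset)
  ultimately have cnt: "of_nat (card (letters j - {a, b})) = of_nat j - (1::'a)" by (simp add: of_nat_diff)
  define \<beta> where "\<beta> = \<alpha> / 2"
  have \<alpha>: "\<alpha> = 2 * \<beta>" "\<alpha> / 2 = \<beta>" using two by (simp_all add: \<beta>_def)
  have p: "(transpose a b, s) \<in> plus_points j \<longleftrightarrow> s = Pos"
    using ab by (auto simp: plus_points_def transpose_in_points_iff)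
  have wsum: "(\<Sum>d\<in>letters j - {a, b}. coord v (transpose a b, s) - coord v (transpose b d, s))
      + (\<Sum>d\<in>letters j - {a, b}. coord v (transpose a b, s) - coord v (transpose a d, s)) =
      of_nat j * coord v (transpose a b, s) * 2 - (row_sum v s (letters j) a + row_sum v s (letters j) b)"
    using ab by (simp add: sum_subtractf cnt sum_row_Diff[OF v _ ab(3)] algebra_simps)
  show ?thesis
    unfolding triple_system.lookup_point_sum_mult[OF triple_system_double_A sub v] p
      sum_collinear_double[OF v abn ab(3)] sum_wedge_double[OF v abn ab(3) jn]
      if_P[OF ab(1)] if_P[OF ab(2)] wsum \<alpha>(2)
    unfolding \<alpha>(1) by (cases s) (simp_all add: algebra_simps)
qed

text \<open>If only \<open>a\<close> is a letter of \<open>\<A>\<^sub>j\<close>, the summands of \<open>S\<^sub>j\<close> that meet \<open>{a, b}\<close> are the edges \<open>{a, d}\<close>, which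
exchange \<open>{a, b}\<close> with \<open>{d, b}\<close> and preserve the sign.\<close>

lemma coord_mult_crossing:
  fixes v :: "(nat \<Rightarrow> nat) \<times> sign \<Rightarrow>\<^sub>0 'a::field"
  assumes v: "v \<in> matsuo_carrier (double_A n)" and jn: "j \<le> n"
    and ab: "a \<in> letters j" "b \<in> letters n" "b \<notin> letters j"
  shows "coord (matsuo_mult \<alpha> (double_A n) (point_sum (plus_points j)) v) (transpose a b, s) =
    \<alpha> / 2 * ((of_nat j + 1) * coord v (transpose a b, s) - row_sum v s (letters j) b)"
proof -
  have sub: "plus_points j \<subseteq> points (double_A n)"
    using points_fischer_A_mono[OF jn] by (auto simp: plus_points_def points_double_A)
  have ne: "a \<noteq> b" and an: "a \<in> letters n" using ab jn by auto
  have "letters j - {a, b} = letters j - {a}" using ab(3) by blast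
  then have cnt: "card (letters j - {a, b}) = j" using ab(1) by (simp add: card_Diff_subset)
  have p: "(transpose a b, s) \<notin> plus_points j"
    using ab by (auto simp: plus_points_def transpose_in_points_iff)
  have wsum: "(\<Sum>d\<in>letters j - {a, b}. coord v (transpose a b, s) - coord v (transpose b d, s)) =
      (of_nat j + 1) * coord v (transpose a b, s) - row_sum v s (letters j) b"
    using ab by (simp add: sum_subtractf cnt sum_row_Diff[OF v _ ne] algebra_simps)
  show ?thesis
    unfolding triple_system.lookup_point_sum_mult[OF triple_system_double_A sub v]
      sum_wedge_double[OF v an ab(2) ne jn] if_P[OF ab(1)] if_not_P[OF ab(3)] if_not_P[OF p] wsum
    by simp
qed

lemma coord_mult_outside:
  fixes v :: "(nat \<Rightarrow> nat) \<times> sign \<Rightarrow>\<^sub>0 'a::field"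
  assumes v: "v \<in> matsuo_carrier (double_A n)" and jn: "j \<le> n"
    and ab: "a \<in> letters n" "b \<in> letters n" "a \<noteq> b" "a \<notin> letters j" "b \<notin> letters j"
  shows "coord (matsuo_mult \<alpha> (double_A n) (point_sum (plus_points j)) v) (transpose a b, s) = 0"
proof -
  have sub: "plus_points j \<subseteq> points (double_A n)"
    using points_fischer_A_mono[OF jn] by (auto simp: plus_points_def points_double_A)
  have p: "(transpose a b, s) \<notin> plus_points j"
    using ab by (auto simp: plus_points_def transpose_in_points_iff)
  show ?thesis
    unfolding triple_system.lookup_point_sum_mult[OF triple_system_double_A sub v]
      sum_wedge_double[OF v ab(1-3) jn] if_not_P[OF ab(4)] if_not_P[OF ab(5)] if_not_P[OF p]
    by simp
qed

lemma vector_eqI: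
  assumes "u \<in> matsuo_carrier (double_A n)" "v \<in> matsuo_carrier (double_A n)"
    and "\<And>a b s. \<lbrakk>a \<in> letters n; b \<in> letters n; a \<noteq> b\<rbrakk> \<Longrightarrow>
      coord u (transpose a b, s) = coord v (transpose a b, s)"
  shows "u = v"
proof (rule poly_mapping_eqI)
  fix p :: "(nat \<Rightarrow> nat) \<times> sign"
  show "coord u p = coord v p"
  proof (cases "p \<in> points (double_A n)")
    case True
    then show ?thesis using assms(3) by (cases p) (auto simp: points_double_A points_fischer_A)
  next
    case False
    then have "coord u p = 0" "coord v p = 0" using assms(1,2) by (auto simp: matsuo_carrier_def in_keys_iff)
    then show ?thesis by simp
  qed
qed

lemma scale_in_carrier: "v \<in> matsuo_carrier G \<Longrightarrow> scale k v \<in> matsuo_carrier G"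
  by (auto simp: matsuo_carrier_def in_keys_iff)

lemma point_sum_in_carrier: "j \<le> n \<Longrightarrow> point_sum (plus_points j) \<in> matsuo_carrier (double_A n)"
  using points_fischer_A_mono[of j n]
  by (auto simp: matsuo_carrier_def keys_point_sum plus_points_def points_double_A finite_points_fischer_A)

lemma plus_points_mult_in_carrier:
  "\<lbrakk>v \<in> matsuo_carrier (double_A n); j \<le> n\<rbrakk> \<Longrightarrow>
    matsuo_mult \<alpha> (double_A n) (point_sum (plus_points j)) v \<in> matsuo_carrier (double_A n)"
  using triple_system.matsuo_mult_in_carrier[OF triple_system_double_A] point_sum_in_carrier by blast

text \<open>The sum is over ordered pairs, so that the weight of the edge \<open>{a, b}\<close> is \<open>\<kappa> s * (g a * h b + g b * h a)\<close>
without a choice of orientation.\<close>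

definition product_vector ::
    "nat \<Rightarrow> (sign \<Rightarrow> 'a) \<Rightarrow> (nat \<Rightarrow> 'a) \<Rightarrow> (nat \<Rightarrow> 'a) \<Rightarrow> ((nat \<Rightarrow> nat) \<times> sign \<Rightarrow>\<^sub>0 'a::field)" where
  "product_vector n \<kappa> g h =
    (\<Sum>(a, b, s) | (a, b, s) \<in> letters n \<times> letters n \<times> {Pos, Neg} \<and> a \<noteq> b.
      scale (\<kappa> s * g a * h b) (pt (transpose a b, s)))"

lemma coord_product_vector:
  assumes "a \<in> letters n" "b \<in> letters n" "a \<noteq> b"
  shows "coord (product_vector n \<kappa> g h) (transpose a b, s) = \<kappa> s * (g a * h b + g b * h a)"
proof -
  let ?T = "{(a, b, s). (a, b, s) \<in> letters n \<times> letters n \<times> {Pos, Neg} \<and> a \<noteq> b}"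
  have fin: "finite ?T"
    by (rule finite_subset[of _ "letters n \<times> letters n \<times> {Pos, Neg}"]) auto
  have "coord (product_vector n \<kappa> g h) (transpose a b, s) =
    (\<Sum>(x, y, t)\<in>?T. (\<kappa> t * g x * h y) * (if transpose x y = transpose a b \<and> t = s then 1 else 0))"
    unfolding product_vector_def lookup_sum
    by (intro sum.cong) (auto simp: lookup_single when_def)
  also have "\<dots> = (\<Sum>p\<in>?T. (if p = (a, b, s) then \<kappa> s * g a * h b else 0) + (if p = (b, a, s) then \<kappa> s * g b * h a else 0))"
    using assms(3) by (intro sum.cong) (auto simp: transpose_eq_transpose_iff split: if_splits)
  also have "\<dots> = \<kappa> s * g a * h b + \<kappa> s * g b * h a"
    using assms fin sign_UNIV by (simp add: sum.distrib)
  finally show ?thesis by (simp add: algebra_simps)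
qed

lemma product_vector_in_carrier: "product_vector n \<kappa> g h \<in> matsuo_carrier (double_A n)"
proof -
  have "coord (product_vector n \<kappa> g h) p = 0" if "p \<notin> points (double_A n)" for p
    unfolding product_vector_def lookup_sum
    using that by (intro sum.neutral)
      (auto simp: lookup_single when_def points_double_A transpose_in_points_iff)
  then show ?thesis by (auto simp: matsuo_carrier_def in_keys_iff)
qed

text \<open>The disjointness of the supports of \<open>g\<close> and \<open>h\<close> makes the formula for the weights vanish on the diagonal,
so the sum may run over all of \<open>K\<close>.\<close>

lemma row_sum_product_vector:
  assumes "\<And>x. g x * h x = 0" "a \<in> letters n" "K \<subseteq> letters n"
  shows "row_sum (product_vector n \<kappa> g h) s K a = \<kappa> s * (g a * sum h K + h a * sum g K)"
proof -
  have "coord (product_vector n \<kappa> g h) (transpose a d, s) = \<kappa> s * (g a * h d) + \<kappa> s * (h a * g d)" if "d \<in> K" for d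
  proof (cases "d = a")
    case True
    have "h a * g a = 0" using assms(1)[of a] by (simp only: mult.commute)
    then show ?thesis
      unfolding True coord_transpose_self[OF product_vector_in_carrier[of n \<kappa> g h]] assms(1) by simp
  next
    case False
    then show ?thesis
      using assms(2,3) that coord_product_vector[of a n d \<kappa> g h s] by (auto simp: algebra_simps)
  qed
  then show ?thesis
    unfolding row_sum_def by (simp add: sum.distrib sum_distrib_left distrib_left)
qed

section \<open>Eigenvectors that are products of letter functions\<close>

text \<open>Weights on the star of a letter \<open>e\<close> outside \<open>\<A>\<^sub>j\<close>, opposite on the two signs.  Multiplying \<open>(a, e)\<^sup>\<plusminus>\<close> by \<open>S\<^sub>j\<close> produces
terms inside \<open>\<A>\<^sub>j\<close> that do not depend on the sign, so they cancel; on the star, \<open>S\<^sub>j\<close> acts on \<open>h\<close> as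
\<open>\<alpha> / 2\<close> times the Laplacian of the complete graph on the letters of \<open>\<A>\<^sub>j\<close>.\<close>

lemma eigenvector_outside:
  fixes \<alpha> \<mu> :: "'a::field"
  assumes two: "(2::'a) \<noteq> 0" and jn: "j \<le> n"
    and e: "e \<in> letters n" "e \<notin> letters j" "h e = 0"
    and \<kappa>: "\<kappa> Neg = - \<kappa> Pos"
    and inner: "\<And>d. d \<in> letters j \<Longrightarrow> \<alpha> / 2 * ((of_nat j + 1) * h d - sum h (letters j)) = \<mu> * h d"
    and outer: "\<And>d. d \<notin> letters j \<Longrightarrow> \<mu> * h d = 0"
  defines "v \<equiv> product_vector n \<kappa> (\<lambda>x. if x = e then 1 else 0) h"
  shows "matsuo_mult \<alpha> (double_A n) (point_sum (plus_points j)) v = scale \<mu> v"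
proof (rule vector_eqI)
  let ?g = "\<lambda>x. if x = e then 1 else 0 :: 'a"
  show car: "scale \<mu> v \<in> matsuo_carrier (double_A n)"
    "matsuo_mult \<alpha> (double_A n) (point_sum (plus_points j)) v \<in> matsuo_carrier (double_A n)"
    unfolding v_def by (intro scale_in_carrier plus_points_mult_in_carrier product_vector_in_carrier jn)+
  have vcar: "v \<in> matsuo_carrier (double_A n)"
    unfolding v_def by (rule product_vector_in_carrier)
  have sub: "letters j \<subseteq> letters n" using jn by auto
  have gsum: "sum ?g (letters j) = 0" using e(2) by (intro sum.neutral) auto
  have gh: "?g x * h x = 0" for x using e(3) by simp
  have row: "row_sum v s (letters j) a = \<kappa> s * (?g a * sum h (letters j))" if "a \<in> letters n" for s a
    unfolding v_def using row_sum_product_vector[of ?g h a n "letters j" \<kappa> s] gh that sub gsum by simp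
  have full: "row_sum v Pos (letters n) a + row_sum v Neg (letters n) a = 0" if "a \<in> letters n" for a
    unfolding v_def using row_sum_product_vector[of ?g h a n "letters n" \<kappa>] gh that \<kappa> by simp
  have co: "coord v (transpose a b, s) = \<kappa> s * (?g a * h b + ?g b * h a)"
    if "a \<in> letters n" "b \<in> letters n" "a \<noteq> b" for a b s
    unfolding v_def by (rule coord_product_vector[OF that])
  have scaled: "\<alpha> / 2 * ((of_nat j + 1) * (k * h d) - k * sum h (letters j)) = \<mu> * (k * h d)"
    if "d \<in> letters j" for d k
  proof -
    have "\<alpha> / 2 * ((of_nat j + 1) * (k * h d) - k * sum h (letters j)) =
      k * (\<alpha> / 2 * ((of_nat j + 1) * h d - sum h (letters j)))"
      by (simp only: algebra_simps)
    then show ?thesis unfolding inner[OF that] by (simp only: mult.left_commute)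
  qed
  have crossing: "coord (matsuo_mult \<alpha> (double_A n) (point_sum (plus_points j)) v) (transpose a b, s) =
      coord (scale \<mu> v) (transpose a b, s)"
    if ab: "a \<in> letters j" "b \<in> letters n" "b \<notin> letters j" for a b s
  proof -
    have "a \<noteq> b" "a \<noteq> e" "a \<in> letters n" using ab e(2) sub by auto
    then show ?thesis
      unfolding coord_mult_crossing[OF vcar jn ab] row[OF ab(2)] co[OF \<open>a \<in> letters n\<close> ab(2) \<open>a \<noteq> b\<close>]
        lookup_scale
      using scaled[OF ab(1), of "\<kappa> s"] two by simp
  qed
  fix a b s assume ab: "a \<in> letters n" "b \<in> letters n" "a \<noteq> b"
  consider "a \<in> letters j" "b \<in> letters j" | "a \<in> letters j" "b \<notin> letters j"
    | "a \<notin> letters j" "b \<in> letters j" | "a \<notin> letters j" "b \<notin> letters j" by blast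
  then show "coord (matsuo_mult \<alpha> (double_A n) (point_sum (plus_points j)) v) (transpose a b, s) =
      coord (scale \<mu> v) (transpose a b, s)"
  proof cases
    case 1
    then have "a \<noteq> e" "b \<noteq> e" using e(2) by auto
    moreover have "row_sum v Pos (letters n) a + row_sum v Neg (letters n) a
      + row_sum v Pos (letters n) b + row_sum v Neg (letters n) b = 0"
      using full[OF ab(1)] full[OF ab(2)] by (simp add: add.assoc)
    ultimately show ?thesis
      unfolding coord_mult_inside[OF two vcar jn 1 ab(3)] lookup_scale co[OF ab] row[OF ab(1)] row[OF ab(2)]
      by simp
  next
    case 2
    then show ?thesis using crossing ab by blast
  next
    case 3
    then show ?thesis using crossing[OF 3(2) ab(1) 3(1)] by (simp add: transpose_commute)
  next
    case 4
    show ?thesis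
      using outer[OF 4(1)] outer[OF 4(2)]
      unfolding coord_mult_outside[OF vcar jn ab 4] by (auto simp: co[OF ab] e(3))
  qed
qed

abbreviation (input) difference_12 :: "nat \<Rightarrow> 'a::field" where
  "difference_12 \<equiv> \<lambda>x. if x = 1 then 1 else if x = 2 then - 1 else 0"

text \<open>The function \<open>g\<close> is \<open>1\<close> at the letter \<open>1\<close>, \<open>-1\<close> at \<open>2\<close> and sums to zero, so that row sums vanish except
at these two letters.  Exchanging the letters \<open>1\<close> and \<open>2\<close> negates the vector, and the eigenvalue equation only has to be
checked on the edges between \<open>1\<close> and a third letter \<open>d\<close>, inside or outside \<open>\<A>\<^sub>j\<close>.\<close>

lemma eigenvector_inside:
  fixes \<alpha> \<mu> :: "'a::field"
  assumes two: "(2::'a) \<noteq> 0" and jn: "j \<le> n" "1 \<le> j"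
    and h: "h 1 = 0" "h 2 = 0"
    and minus: "\<And>d. d \<in> letters j - {1, 2} \<Longrightarrow>
      \<kappa> Neg * (\<alpha> * of_nat j * h d - \<alpha> / 2 * sum h (letters j)) = \<mu> * (\<kappa> Neg * h d)"
    and plus: "\<And>d. d \<in> letters j - {1, 2} \<Longrightarrow>
      \<kappa> Pos * (\<alpha> * of_nat j * h d - \<alpha> / 2 * sum h (letters j))
      + ((1 - \<alpha>) * \<kappa> Pos - \<alpha> * \<kappa> Neg) * h d
      + \<alpha> / 2 * (\<kappa> Pos + \<kappa> Neg) * sum h (letters n) = \<mu> * (\<kappa> Pos * h d)"
    and outer: "\<And>d. d \<in> letters n - letters j \<Longrightarrow> \<alpha> / 2 * (of_nat j + 1) * h d = \<mu> * h d"
  defines "v \<equiv> product_vector n \<kappa> difference_12 h"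
  shows "matsuo_mult \<alpha> (double_A n) (point_sum (plus_points j)) v = scale \<mu> v"
proof (rule vector_eqI)
  define g where "g = (difference_12 :: nat \<Rightarrow> 'a)"
  have g0: "g d = 0" if "d \<notin> {1, 2}" for d using that by (simp add: g_def)
  have g12: "g 1 + g 2 = 0" by (simp add: g_def)
  have v: "v = product_vector n \<kappa> g h" unfolding v_def g_def ..
  show car: "scale \<mu> v \<in> matsuo_carrier (double_A n)"
    "matsuo_mult \<alpha> (double_A n) (point_sum (plus_points j)) v \<in> matsuo_carrier (double_A n)"
    unfolding v by (intro scale_in_carrier plus_points_mult_in_carrier product_vector_in_carrier jn)+
  have vcar: "v \<in> matsuo_carrier (double_A n)"
    unfolding v by (rule product_vector_in_carrier)
  have sub: "letters j \<subseteq> letters n" using jn by auto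
  have gsum: "sum g (letters k) = 0" if "1 \<le> k" for k
  proof -
    have "sum g (letters k) = sum g {1, 2}"
      using that by (intro sum.mono_neutral_right) (auto simp: g_def)
    then show ?thesis using g12 by simp
  qed
  have gh: "g x * h x = 0" for x using h by (simp add: g_def)
  have row: "row_sum v s (letters k) a = \<kappa> s * (g a * sum h (letters k))"
    if "a \<in> letters n" "k \<le> n" "1 \<le> k" for s a k
  proof -
    have "letters k \<subseteq> letters n" using that by auto
    then show ?thesis
      unfolding v using row_sum_product_vector[of g h a n "letters k" \<kappa> s] gh that gsum[of k] by simp
  qed
  have co: "coord v (transpose a b, s) = \<kappa> s * (g a * h b + g b * h a)"
    if "a \<in> letters n" "b \<in> letters n" "a \<noteq> b" for a b s
    unfolding v by (rule coord_product_vector[OF that])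
  have n1: "1 \<le> n" using jn by simp
  have crossing: "coord (matsuo_mult \<alpha> (double_A n) (point_sum (plus_points j)) v) (transpose a b, s) =
      coord (scale \<mu> v) (transpose a b, s)"
    if ab: "a \<in> letters j" "b \<in> letters n" "b \<notin> letters j" for a b s
  proof -
    have ne: "a \<noteq> b" "a \<in> letters n" using ab sub by auto
    have g: "g b = 0" using ab(3) jn by (intro g0) auto
    have "\<alpha> / 2 * (of_nat j + 1) * h b = \<mu> * h b" using outer ab by blast
    then have eq: "\<alpha> / 2 * ((of_nat j + 1) * (k * (x * h b))) = \<mu> * (k * (x * h b))" for k x
      by (metis mult.assoc mult.left_commute)
    show ?thesis
      unfolding coord_mult_crossing[OF vcar jn(1) ab] row[OF ab(2) jn] co[OF ne(2) ab(2) ne(1)] lookup_scale g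
      using eq by simp
  qed
  have inside: "\<kappa> s * (\<alpha> * of_nat j * (g a * h b + g b * h a) - \<alpha> / 2 * (g a + g b) * sum h (letters j))
      + (if s = Pos then ((1 - \<alpha>) * \<kappa> Pos - \<alpha> * \<kappa> Neg) * (g a * h b + g b * h a)
        + \<alpha> / 2 * (\<kappa> Pos + \<kappa> Neg) * (g a + g b) * sum h (letters n) else 0)
      = \<mu> * (\<kappa> s * (g a * h b + g b * h a))" if ab: "a \<in> letters j" "b \<in> letters j" "a \<noteq> b" for a b s
  proof -
    have basic: "\<kappa> s * (\<alpha> * of_nat j * (x * h d) - \<alpha> / 2 * x * sum h (letters j))
      + (if s = Pos then ((1 - \<alpha>) * \<kappa> Pos - \<alpha> * \<kappa> Neg) * (x * h d)
        + \<alpha> / 2 * (\<kappa> Pos + \<kappa> Neg) * x * sum h (letters n) else 0) = \<mu> * (\<kappa> s * (x * h d))"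
      if "d \<in> letters j - {1, 2}" for d x
    proof (cases s)
      case Pos
      show ?thesis using arg_cong[OF plus[OF that], of "(*) x"] Pos by (simp add: algebra_simps)
    next
      case Neg
      show ?thesis using arg_cong[OF minus[OF that], of "(*) x"] Neg by (simp add: algebra_simps)
    qed
    consider "a \<in> {1, 2}" "b \<in> {1, 2}" | "a \<in> {1, 2}" "b \<notin> {1, 2}" | "a \<notin> {1, 2}" "b \<in> {1, 2}"
      | "a \<notin> {1, 2}" "b \<notin> {1, 2}" by blast
    then show ?thesis
    proof cases
      case 1
      then have "g a * h b + g b * h a = 0" "g a + g b = 0" using h ab(3) by (auto simp: g_def)
      then show ?thesis by simp
    next
      case 2
      then have "g b = 0" "h a = 0" using h g0 by auto
      moreover have "b \<in> letters j - {1, 2}" using 2 ab(2) by blast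
      ultimately show ?thesis
        using basic[of b "g a"] by (simp only: mult_zero_left mult_zero_right add_0_right)
    next
      case 3
      then have "g a = 0" "h b = 0" using h g0 by auto
      moreover have "a \<in> letters j - {1, 2}" using 3 ab(1) by blast
      ultimately show ?thesis
        using basic[of a "g b"] by (simp only: mult_zero_left mult_zero_right add_0_left)
    next
      case 4
      then have "g a = 0" "g b = 0" using g0 by auto
      then show ?thesis by simp
    qed
  qed
  fix a b s assume ab: "a \<in> letters n" "b \<in> letters n" "a \<noteq> b"
  consider "a \<in> letters j" "b \<in> letters j" | "a \<in> letters j" "b \<notin> letters j"
    | "a \<notin> letters j" "b \<in> letters j" | "a \<notin> letters j" "b \<notin> letters j" by blast
  then show "coord (matsuo_mult \<alpha> (double_A n) (point_sum (plus_points j)) v) (transpose a b, s) =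
      coord (scale \<mu> v) (transpose a b, s)"
  proof cases
    case 1
    show ?thesis
      unfolding coord_mult_inside[OF two vcar jn(1) 1 ab(3)] row[OF ab(1) jn] row[OF ab(2) jn]
        row[OF ab(1) order.refl n1] row[OF ab(2) order.refl n1] co[OF ab] lookup_scale inside[OF 1 ab(3), of s, symmetric]
      by (cases s) (simp_all only: if_True if_False sign.distinct algebra_simps)
  next
    case 2
    then show ?thesis using crossing ab by blast
  next
    case 3
    then show ?thesis using crossing[OF 3(2) ab(1) 3(1)] by (simp add: transpose_commute)
  next
    case 4
    then have "g a = 0" "g b = 0" using jn g0[of a] g0[of b] by auto
    then show ?thesis
      unfolding coord_mult_outside[OF vcar jn(1) ab 4] lookup_scale co[OF ab] by simp
  qed
qed

section \<open>The spectrum of the difference of two consecutive identities\<close>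

lemma plus_points_mult_span:
  fixes \<alpha> :: "'a::field"
  assumes "(2::'a) \<noteq> 0" "1 \<le> j" "j \<le> n" "v \<in> free.span (pt ` plus_points j)"
  shows "matsuo_mult \<alpha> (double_A n) (point_sum (plus_points j)) v = scale (1 + \<alpha> * (of_nat j - 1)) v"
  using regular_subsystem.point_sum_mult[OF regular_plus_points[OF assms(2,3)] assms(4), of \<alpha>] assms(1,2)
  by (simp add: of_nat_diff)

lemma point_sum_in_span_plus: "point_sum (plus_points j) \<in> free.span (pt ` plus_points j)"
  by (simp add: span_pt_image keys_point_sum plus_points_def finite_points_fischer_A)

lemma span_plus_points_mono:
  assumes "j \<le> k" "v \<in> free.span (pt ` plus_points j)"
  shows "v \<in> free.span (pt ` plus_points k)"
  using assms points_fischer_A_mono[of j k] by (auto simp: span_pt_image plus_points_def)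

lemma span_plus_points_carrier: "free.span (pt ` plus_points n) \<subseteq> matsuo_carrier (double_A n)"
  by (auto simp: span_pt_image matsuo_carrier_def plus_points_def points_double_A)

lemma letters_Suc: "letters (Suc m) = insert (m + 2) (letters m)" "m + 2 \<notin> letters m"
  by auto

lemma sum_letters_Suc: "sum f (letters (Suc m)) = f (m + 2) + (sum f (letters m) :: 'a::comm_monoid_add)"
  unfolding letters_Suc(1) by (rule sum.insert) auto

text \<open>The equations for a function on the letters \<open>1, \<dots>, m + 2\<close> that arise twice below: for the weights on the star of an
outside letter and for the row sums inside.  Adding them all up gives \<open>k * F = 0\<close> for the total \<open>F\<close>; then the
values at \<open>m + 2\<close> and at the other letters are multiplied by scalars different from \<open>k\<close>.\<close>

lemma vertex_weights_zero:
  fixes f :: "nat \<Rightarrow> 'a::field" and m :: nat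
  defines "F \<equiv> sum f (letters (Suc m))"
  assumes last: "k * f (m + 2) = \<beta> * \<sigma> * ((of_nat m + 2) * f (m + 2) - F)"
    and inner: "\<And>a. a \<in> letters m \<Longrightarrow> k * f a = \<beta> * \<sigma> * ((of_nat m + 2) * f a - F)
      - \<beta> * \<tau> * ((of_nat m + 1) * f a - (F - f (m + 2)))"
    and k: "k \<noteq> 0" "k \<noteq> \<beta> * \<sigma> * (of_nat m + 2)" "k \<noteq> \<beta> * \<sigma> * (of_nat m + 2) - \<beta> * \<tau> * (of_nat m + 1)"
    and a: "a \<in> letters (Suc m)"
  shows "f a = 0"
proof -
  have F: "F = f (m + 2) + sum f (letters m)" unfolding F_def by (rule sum_letters_Suc)
  define G where "G = sum f (letters m)"
  have "k * G = (\<Sum>a\<in>letters m. \<beta> * \<sigma> * ((of_nat m + 2) * f a - F)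
      - \<beta> * \<tau> * ((of_nat m + 1) * f a - (F - f (m + 2))))"
    unfolding G_def sum_distrib_left using inner by (rule sum.cong[OF refl])
  also have "\<dots> = \<beta> * \<sigma> * ((of_nat m + 2) * G - (of_nat m + 1) * F)
      - \<beta> * \<tau> * ((of_nat m + 1) * G - (of_nat m + 1) * (F - f (m + 2)))"
    unfolding sum_subtractf sum_distrib_left[symmetric] G_def by (simp add: algebra_simps)
  also have "F - f (m + 2) = G" using F G_def by simp
  finally have kG: "k * G = \<beta> * \<sigma> * ((of_nat m + 2) * G - (of_nat m + 1) * F)" by simp
  have "k * F = k * f (m + 2) + k * G" unfolding F G_def by (simp only: distrib_left)
  also have "\<dots> = \<beta> * \<sigma> * ((of_nat m + 2) * (f (m + 2) + G) - (of_nat m + 2) * F)"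
    unfolding kG last by (simp only: algebra_simps) simp
  also have "\<dots> = 0" unfolding F G_def by simp
  finally have "k * F = 0" .
  then have F0: "F = 0" using k(1) by simp
  then have "(k - \<beta> * \<sigma> * (of_nat m + 2)) * f (m + 2) = 0" using last by (simp add: algebra_simps)
  then have last0: "f (m + 2) = 0" using k(2) by simp
  show ?thesis
  proof (cases "a = m + 2")
    case False
    then have "a \<in> letters m" using a letters_Suc(1) by blast
    then have "(k - (\<beta> * \<sigma> * (of_nat m + 2) - \<beta> * \<tau> * (of_nat m + 1))) * f a = 0"
      using inner[of a] F0 last0 by (simp add: algebra_simps)
    then show ?thesis using k(3) by simp
  qed (use last0 in simp)
qed

text \<open>For \<open>e\<^sub>i\<close> the index is \<open>i = m + 1\<close>, and \<open>\<sigma>\<close>, \<open>\<tau>\<close> stand for the inverses of \<open>1 + \<alpha> (i - 1)\<close> and \<open>1 + \<alpha> (i - 2)\<close>, so that the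
vector that multiplies \<open>v\<close> is \<open>e\<^sub>i\<close>.  The values excluded for \<open>k\<close> are, in this order, \<open>1\<close>, \<open>0\<close>, \<open>\<eta>(i)\<close>, \<open>1 - \<eta>(i - 1)\<close>,
\<open>\<eta>(i) - \<eta>(i - 1)\<close>, \<open>\<eta>'(i) - \<eta>(i - 1)\<close> and \<open>\<eta>'(i) - \<eta>'(i - 1)\<close>, where \<open>\<eta>'\<close> is \<open>eta_hat\<close>.
The coordinates of \<open>v\<close> are shown to vanish layer by layer, each layer being unaffected by
those after it.\<close>

lemma spectrum_idem_upper:
  fixes \<alpha> \<sigma> \<tau> k :: "'a::field"
  assumes two: "(2::'a) \<noteq> 0" and mn: "Suc m \<le> n" "1 \<le> m"
    and \<sigma>: "\<sigma> * (1 + \<alpha> * of_nat m) = 1" and \<tau>: "\<tau> * (1 + \<alpha> * (of_nat m - 1)) = 1"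
    and v: "v \<in> matsuo_carrier (double_A n)"
    and eq: "matsuo_mult \<alpha> (double_A n)
      (scale \<sigma> (point_sum (plus_points (Suc m))) - scale \<tau> (point_sum (plus_points m))) v = scale k v"
    and k: "k \<noteq> 1" "k \<noteq> 0" "k \<noteq> \<alpha> / 2 * \<sigma> * (of_nat m + 2)" "k \<noteq> 1 - \<alpha> / 2 * \<tau> * (of_nat m + 1)"
      "k \<noteq> \<alpha> / 2 * \<sigma> * (of_nat m + 2) - \<alpha> / 2 * \<tau> * (of_nat m + 1)"
      "k \<noteq> \<alpha> * \<sigma> * (of_nat m + 1) - \<alpha> / 2 * \<tau> * (of_nat m + 1)"
      "k \<noteq> \<alpha> * \<sigma> * (of_nat m + 1) - \<alpha> * \<tau> * of_nat m"
  shows "v = 0"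
proof -
  let ?S = "\<lambda>j. matsuo_mult \<alpha> (double_A n) (point_sum (plus_points j)) v"
  let ?z = "m + 2"
  define \<beta> where "\<beta> = \<alpha> / 2"
  have \<alpha>: "\<alpha> / 2 = \<beta>" "\<alpha> = 2 * \<beta>" using two by (simp_all add: \<beta>_def)
  have mn': "m \<le> n" using mn by simp
  have coords: "k * coord v p = \<sigma> * coord (?S (Suc m)) p - \<tau> * coord (?S m) p" for p
    using arg_cong[OF eq, of "\<lambda>w. coord w p"]
    unfolding matsuo_mult_diff_scale_left lookup_minus lookup_scale by simp
  have sub: "letters m \<subseteq> letters (Suc m)" "letters (Suc m) \<subseteq> letters n" "?z \<in> letters (Suc m)"
    using mn by auto
  have split: "a = ?z \<or> a \<in> letters m" if "a \<in> letters (Suc m)" for a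
    using that unfolding letters_Suc(1) by blast
  have outside: "coord v (transpose a b, s) = 0"
    if ab: "a \<in> letters n" "b \<in> letters n" "a \<noteq> b" "a \<notin> letters (Suc m)" "b \<notin> letters (Suc m)" for a b s
  proof -
    have "a \<notin> letters m" "b \<notin> letters m" using ab sub by blast+
    then have "k * coord v (transpose a b, s) = 0"
      unfolding coords using coord_mult_outside[OF v mn(1) ab] coord_mult_outside[OF v mn' ab(1-3)] by simp
    then show ?thesis using k(2) by simp
  qed
  \<comment> \<open>Edges leaving the letters of \<open>\<A>\<^sub>i\<close>, for a fixed outer end \<open>b\<close> and a fixed sign.\<close>
  have crossing: "coord v (transpose a b, s) = 0"
    if ab: "a \<in> letters (Suc m)" "b \<in> letters n" "b \<notin> letters (Suc m)" for a b s
  proof -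
    define f where "f a = coord v (transpose a b, s)" for a
    have bm: "b \<notin> letters m" "b \<noteq> ?z" using ab sub by blast+
    have row: "row_sum v s K b = sum f K" for K
      unfolding row_sum_def f_def by (simp add: transpose_commute)
    have "f a = 0"
    proof (rule vertex_weights_zero[of k f m \<beta> \<sigma> \<tau>])
      have "coord (?S m) (transpose ?z b, s) = 0"
        using sub ab(2) bm letters_Suc(2) by (intro coord_mult_outside[OF v mn']) auto
      then show "k * f ?z = \<beta> * \<sigma> * ((of_nat m + 2) * f ?z - sum f (letters (Suc m)))"
        unfolding f_def[of ?z] coords coord_mult_crossing[OF v mn(1) sub(3) ab(2,3)] row \<alpha>(1)
        by (simp add: algebra_simps)
    next
      fix a assume a: "a \<in> letters m"
      have "sum f (letters m) = sum f (letters (Suc m)) - f ?z" unfolding sum_letters_Suc by simp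
      then show "k * f a = \<beta> * \<sigma> * ((of_nat m + 2) * f a - sum f (letters (Suc m)))
          - \<beta> * \<tau> * ((of_nat m + 1) * f a - (sum f (letters (Suc m)) - f ?z))"
        unfolding f_def[of a] coords coord_mult_crossing[OF v mn(1) subsetD[OF sub(1) a] ab(2,3)]
          coord_mult_crossing[OF v mn' a ab(2) bm(1)] row \<alpha>(1)
        by (simp add: algebra_simps)
    qed (use k \<alpha>(1) ab(1) in simp_all)
    then show ?thesis unfolding f_def .
  qed
  define c where "c a b = coord v (transpose a b, Neg)" for a b
  have c_comm: "c a b = c b a" for a b unfolding c_def by (simp add: transpose_commute)
  have c_self: "c a a = 0" for a unfolding c_def by (rule coord_transpose_self[OF v])
  \<comment> \<open>Negative edges inside \<open>\<A>\<^sub>i\<close>: first the row sums \<open>C\<close>, then the weights themselves.\<close>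
  define C where "C a = sum (c a) (letters (Suc m))" for a
  define F where "F = sum C (letters (Suc m))"
  have row: "row_sum v Neg K a = sum (c a) K" for K a unfolding row_sum_def c_def ..
  have row_m: "sum (c a) (letters m) = C a - c a ?z" for a
    unfolding C_def sum_letters_Suc by simp
  have eq_z: "k * c a ?z = \<sigma> * (\<alpha> * (of_nat m + 1) * c a ?z - \<beta> * (C a + C ?z))
      - \<tau> * \<beta> * ((of_nat m + 1) * c a ?z - C ?z)" if a: "a \<in> letters m" for a
  proof -
    have "a \<noteq> ?z" "?z \<in> letters n" using a sub letters_Suc(2) by blast+
    then show ?thesis
      unfolding c_def[of a ?z] coords coord_mult_inside[OF two v mn(1) subsetD[OF sub(1) a] sub(3) \<open>a \<noteq> ?z\<close>]
        coord_mult_crossing[OF v mn' a \<open>?z \<in> letters n\<close> letters_Suc(2)]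
      unfolding c_def[symmetric] row row_m C_def[symmetric] c_self \<alpha>(1)
      by (simp add: algebra_simps)
  qed
  have eq_in: "k * c a b = \<sigma> * (\<alpha> * (of_nat m + 1) * c a b - \<beta> * (C a + C b))
      - \<tau> * (\<alpha> * of_nat m * c a b - \<beta> * (C a - c a ?z + C b - c b ?z))"
    if ab: "a \<in> letters m" "b \<in> letters m" "a \<noteq> b" for a b
    unfolding c_def[of a b] coords
      coord_mult_inside[OF two v mn(1) subsetD[OF sub(1) ab(1)] subsetD[OF sub(1) ab(2)] ab(3)]
      coord_mult_inside[OF two v mn' ab]
    unfolding c_def[symmetric] row row_m C_def[symmetric] \<alpha>(1)
    by (simp add: algebra_simps)
  have F_m: "sum C (letters m) = F - C ?z" unfolding F_def sum_letters_Suc by simp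
  have z_m: "(\<Sum>a\<in>letters m. c a ?z) = C ?z"
    unfolding C_def sum_letters_Suc c_self by (simp add: c_comm)
  have C0: "C a = 0" if "a \<in> letters (Suc m)" for a
  proof (rule vertex_weights_zero[of k C m \<beta> \<sigma> \<tau>, folded F_def])
    have "k * C ?z = (\<Sum>a\<in>letters m. k * c a ?z)"
      unfolding sum_distrib_left[symmetric] z_m ..
    also have "\<dots> = (\<Sum>a\<in>letters m. \<sigma> * (\<alpha> * (of_nat m + 1) * c a ?z - \<beta> * (C a + C ?z))
      - \<tau> * \<beta> * ((of_nat m + 1) * c a ?z - C ?z))"
      using eq_z by (rule sum.cong[OF refl])
    also have "\<dots> = \<sigma> * (\<alpha> * (of_nat m + 1) * C ?z - \<beta> * (F - C ?z + (of_nat m + 1) * C ?z))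
      - \<tau> * \<beta> * ((of_nat m + 1) * C ?z - (of_nat m + 1) * C ?z)"
      unfolding sum_subtractf sum_distrib_left[symmetric] sum.distrib z_m F_m by (simp add: algebra_simps)
    finally show "k * C ?z = \<beta> * \<sigma> * ((of_nat m + 2) * C ?z - F)"
      unfolding \<alpha>(2) by (simp add: algebra_simps)
  next
    fix a assume a: "a \<in> letters m"
    have rem: "sum g (letters m - {a}) = sum g (letters m) - g a" for g :: "nat \<Rightarrow> 'a"
      using a by (simp add: sum_diff1)
    have cnt: "(\<Sum>b\<in>letters m - {a}. x) = of_nat m * x" for x :: 'a
      unfolding rem by (simp add: algebra_simps)
    have "k * (C a - c a ?z) = (\<Sum>b\<in>letters m - {a}. k * c a b)"
      unfolding sum_distrib_left[symmetric] rem row_m c_self by simp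
    also have "\<dots> = (\<Sum>b\<in>letters m - {a}. \<sigma> * (\<alpha> * (of_nat m + 1) * c a b - \<beta> * (C a + C b))
      - \<tau> * (\<alpha> * of_nat m * c a b - \<beta> * (C a - c a ?z + C b - c b ?z)))"
      using eq_in[OF a] by (intro sum.cong) auto
    also have "\<dots> = \<sigma> * (\<alpha> * (of_nat m + 1) * (C a - c a ?z) - \<beta> * (of_nat m * C a + (F - C ?z - C a)))
      - \<tau> * (\<alpha> * of_nat m * (C a - c a ?z) - \<beta> * (of_nat m * C a - of_nat m * c a ?z + (F - C ?z - C a) - (C ?z - c a ?z)))"
      unfolding sum_subtractf sum_distrib_left[symmetric] sum.distrib cnt
      unfolding rem row_m F_m z_m c_self by simp
    finally have rest: "k * (C a - c a ?z) = \<dots>" .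
    have "k * C a = k * (C a - c a ?z) + k * c a ?z" by (simp only: distrib_left[symmetric] diff_add_cancel)
    then show "k * C a = \<beta> * \<sigma> * ((of_nat m + 2) * C a - F)
          - \<beta> * \<tau> * ((of_nat m + 1) * C a - (F - C ?z))"
      unfolding rest eq_z[OF a] unfolding \<alpha>(2) by (simp add: algebra_simps)
  qed (use k \<alpha>(1) that in simp_all)
  have minus: "c a b = 0" if ab: "a \<in> letters (Suc m)" "b \<in> letters (Suc m)" for a b
  proof -
    have z: "c a ?z = 0" if a: "a \<in> letters m" for a
    proof -
      have "(k - (\<alpha> * \<sigma> * (of_nat m + 1) - \<beta> * \<tau> * (of_nat m + 1))) * c a ?z = 0"
        using eq_z[OF a] C0[OF subsetD[OF sub(1) a]] C0[OF sub(3)] by (simp add: algebra_simps)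
      then show ?thesis using k(6) \<alpha>(1) by simp
    qed
    have inner: "c a b = 0" if ab: "a \<in> letters m" "b \<in> letters m" for a b
    proof (cases "a = b")
      case False
      have "(k - (\<alpha> * \<sigma> * (of_nat m + 1) - \<alpha> * \<tau> * of_nat m)) * c a b = 0"
        using eq_in[OF ab False] C0[OF subsetD[OF sub(1) ab(1)]] C0[OF subsetD[OF sub(1) ab(2)]]
          z[OF ab(1)] z[OF ab(2)] by (simp add: algebra_simps)
      then show ?thesis using k(7) by simp
    qed (use c_self in simp)
    show ?thesis using split[OF ab(1)] split[OF ab(2)] z inner c_self c_comm by metis
  qed
  have support: "coord v p = 0" if "p \<notin> plus_points (Suc m)" for p
  proof (cases "p \<in> points (double_A n)")
    case True
    then obtain a b s where p: "p = (transpose a b, s)" "a \<in> letters n" "b \<in> letters n" "a \<noteq> b"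
      by (cases p) (auto simp: points_double_A points_fischer_A)
    show ?thesis
    proof (cases "a \<in> letters (Suc m) \<and> b \<in> letters (Suc m)")
      case True
      then have "s \<noteq> Pos" using that p(1,4) by (auto simp: plus_points_def transpose_in_points_iff)
      then have "s = Neg" by (cases s) auto
      then show ?thesis using minus[of a b] True unfolding p(1) c_def by blast
    next
      case False
      then show ?thesis
        using outside[OF p(2-4), of s] crossing[of a b s] crossing[of b a s] p(2,3) transpose_commute[of a b]
        unfolding p(1) by metis
    qed
  qed (use v in \<open>auto simp: matsuo_carrier_def in_keys_iff\<close>)
  then have "v \<in> free.span (pt ` plus_points (Suc m))"
    by (auto simp: span_pt_image in_keys_iff)
  then have "?S (Suc m) = scale (1 + \<alpha> * of_nat m) v"
    using plus_points_mult_span[OF two _ mn(1), of v \<alpha>] by simp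
  then have coords2: "k * coord v p = coord v p - \<tau> * coord (?S m) p" for p
    using coords[of p] \<sigma> by (simp add: mult.assoc[symmetric])
  \<comment> \<open>The vector \<open>v\<close> is now supported in \<open>\<A>\<^sub>i\<close>, which the identity of \<open>\<A>\<^sub>i\<close>
    fixes.  What is left are the positive edges at the last letter.\<close>
  define x where "x a = coord v (transpose a ?z, Pos)" for a
  have eq_x: "k * x a = x a - \<tau> * \<beta> * ((of_nat m + 1) * x a - sum x (letters m))" if a: "a \<in> letters m" for a
  proof -
    have "row_sum v Pos (letters m) ?z = sum x (letters m)"
      unfolding row_sum_def x_def by (simp add: transpose_commute)
    moreover have "?z \<in> letters n" using sub by blast
    ultimately show ?thesis
      unfolding x_def[of a] coords2 coord_mult_crossing[OF v mn' a \<open>?z \<in> letters n\<close> letters_Suc(2)] \<alpha>(1)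
      by (simp add: algebra_simps)
  qed
  have "k * sum x (letters m) = (\<Sum>a\<in>letters m. x a - \<tau> * \<beta> * ((of_nat m + 1) * x a - sum x (letters m)))"
    unfolding sum_distrib_left using eq_x by (rule sum.cong[OF refl])
  also have "\<dots> = sum x (letters m)"
    unfolding sum_subtractf sum_distrib_left[symmetric] by simp
  finally have "sum x (letters m) = 0" using k(1) by simp
  then have "(k - (1 - \<beta> * \<tau> * (of_nat m + 1))) * x a = 0" if "a \<in> letters m" for a
    using eq_x[OF that] by (simp add: algebra_simps)
  then have x0: "x a = 0" if "a \<in> letters m" for a using that k(4) \<alpha>(1) by force
  have "coord v p = 0" if p: "p \<notin> plus_points m" for p
  proof (cases "p \<in> plus_points (Suc m)")
    case True
    then obtain a b where ab: "p = (transpose a b, Pos)" "a \<in> letters (Suc m)" "b \<in> letters (Suc m)" "a \<noteq> b"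
      by (auto simp: plus_points_def points_fischer_A)
    then have "a = ?z \<and> b \<in> letters m \<or> b = ?z \<and> a \<in> letters m"
      using p split[OF ab(2)] split[OF ab(3)] by (auto simp: plus_points_def transpose_in_points_iff)
    then show ?thesis using x0[of a] x0[of b] transpose_commute[of a b] unfolding ab(1) x_def by metis
  qed (rule support)
  then have "v \<in> free.span (pt ` plus_points m)"
    by (auto simp: span_pt_image in_keys_iff)
  then have "?S m = scale (1 + \<alpha> * (of_nat m - 1)) v"
    by (rule plus_points_mult_span[OF two mn(2) mn'])
  then have "k * coord v p = 0" for p
    using coords2[of p] \<tau> by (simp add: mult.assoc[symmetric])
  then show "v = 0" using k(2) by (intro poly_mapping_eqI) simp
qed

lemma SpecI:
  assumes "v \<in> matsuo_carrier G" "v \<noteq> 0" "matsuo_mult \<alpha> G e v = scale k v"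
  shows "k \<in> Spec \<alpha> G e"
  using assms unfolding Spec_def by blast

lemma product_vector_nonzero:
  assumes "a \<in> letters n" "b \<in> letters n" "a \<noteq> b" "\<kappa> s * (g a * h b + g b * h a) \<noteq> 0"
  shows "product_vector n \<kappa> g h \<noteq> 0"
  using coord_product_vector[OF assms(1-3), of \<kappa> g h s] assms(4) by auto

text \<open>The totals of \<open>h\<close> determine the row sums of a product vector; the value \<open>w\<close> at the letter \<open>m + 2\<close> adjusts
the total over \<open>\<A>\<^sub>m\<^sub>+\<^sub>1\<close> independently of the one over \<open>\<A>\<^sub>m\<close>.\<close>

lemma sum_two_level:
  fixes u w :: "'a::field"
  assumes "1 \<le> p" "p \<le> m + 2"
    and h_def: "h = (\<lambda>x. if x \<in> {p..m + 1} then u else if x = m + 2 then w else 0)"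
  shows "sum h (letters m) = (of_nat m + 2 - of_nat p) * u"
    and "Suc m \<le> n \<Longrightarrow> sum h (letters n) = (of_nat m + 2 - of_nat p) * u + w"
proof -
  have base: "sum h {p..m + 1} = (of_nat m + 2 - of_nat p) * u"
  proof -
    have "sum h {p..m + 1} = (\<Sum>x\<in>{p..m + 1}. u)" unfolding h_def by (rule sum.cong) auto
    also have "\<dots> = of_nat (m + 2 - p) * u" by simp
    finally show ?thesis using assms(2) by (simp add: of_nat_diff)
  qed
  have "sum h (letters m) = sum h {p..m + 1}"
    using assms(1) by (intro sum.mono_neutral_right) (auto simp: h_def)
  then show "sum h (letters m) = (of_nat m + 2 - of_nat p) * u" using base by simp
  assume "Suc m \<le> n"
  then have "sum h (letters n) = sum h (insert (m + 2) {p..m + 1})"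
    using assms(1) by (intro sum.mono_neutral_right) (auto simp: h_def)
  also have "\<dots> = h (m + 2) + sum h {p..m + 1}" by (rule sum.insert) auto
  also have "h (m + 2) = w" by (simp add: h_def)
  finally show "sum h (letters n) = (of_nat m + 2 - of_nat p) * u + w" using base by simp
qed

lemma sum_difference_34:
  assumes "3 \<le> k"
  shows "(\<Sum>x\<in>letters k. if x = 3 then 1 else if x = 4 then - 1 else 0 :: 'a::field) = 0"
proof -
  have "(\<Sum>x\<in>letters k. if x = 3 then 1 else if x = 4 then - 1 else 0 :: 'a) =
      (\<Sum>x\<in>{3, 4 :: nat}. if x = 3 then 1 else if x = 4 then - 1 else 0)"
    using assms by (intro sum.mono_neutral_right) auto
  then show ?thesis by simp
qed

lemma sum_difference_12:
  assumes "1 \<le> k"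
  shows "sum (difference_12 :: nat \<Rightarrow> 'a::field) (letters k) = 0"
proof -
  have "sum (difference_12 :: nat \<Rightarrow> 'a) (letters k) = sum difference_12 {1, 2}"
    using assms by (intro sum.mono_neutral_right) auto
  then show ?thesis by simp
qed

definition sign_fun :: "'a \<Rightarrow> 'a \<Rightarrow> sign \<Rightarrow> 'a" where
  "sign_fun p q s = (case s of Pos \<Rightarrow> p | Neg \<Rightarrow> q)"

lemma sign_fun_simps [simp]: "sign_fun p q Pos = p" "sign_fun p q Neg = q"
  by (simp_all add: sign_fun_def)

text \<open>The weights alternate along the cycle with edges \<open>{1, 3}\<close>, \<open>{3, 2}\<close>, \<open>{2, 4}\<close>, \<open>{4, 1}\<close>, so all row sums vanish.
For negative edge weights \<open>w\<^sup>-\<close> with vanishing row sums, \<open>S\<^sub>j w\<^sup>- = \<alpha> j w\<^sup>- - \<alpha> w\<^sup>+\<close> and \<open>S\<^sub>j w\<^sup>+ = (1 + \<alpha> (j - 1)) w\<^sup>+\<close>,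
and the combination \<open>(1 - \<alpha>) w\<^sup>- + \<alpha> w\<^sup>+\<close> is the eigenvector, with coefficients independent of \<open>j\<close>.\<close>

lemma eigenvector_difference_34:
  fixes \<alpha> :: "'a::field"
  assumes "(2::'a) \<noteq> 0" "j \<le> n" "3 \<le> j"
  shows "matsuo_mult \<alpha> (double_A n) (point_sum (plus_points j))
      (product_vector n (sign_fun \<alpha> (1 - \<alpha>)) difference_12 (\<lambda>x. if x = 3 then 1 else if x = 4 then - 1 else 0)) =
    scale (\<alpha> * of_nat j)
      (product_vector n (sign_fun \<alpha> (1 - \<alpha>)) difference_12 (\<lambda>x. if x = 3 then 1 else if x = 4 then - 1 else 0))"
proof -
  let ?h = "\<lambda>x::nat. if x = 3 then 1 else if x = 4 then - 1 else 0 :: 'a"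
  have H: "sum ?h (letters j) = 0" "sum ?h (letters n) = 0"
    using assms by (intro sum_difference_34, simp)+
  show ?thesis
    by (rule eigenvector_inside) (use assms in \<open>simp_all only: H, auto simp: algebra_simps\<close>)
qed

text \<open>The coefficients \<open>\<alpha>\<close> and \<open>1 - \<alpha>\<close> do not vanish together.\<close>

lemma difference_34_nonzero:
  assumes "3 \<le> n"
  shows "product_vector n (sign_fun \<alpha> (1 - \<alpha>)) difference_12
    (\<lambda>x. if x = 3 then 1 else if x = 4 then - 1 else 0) \<noteq> (0 :: _ \<Rightarrow>\<^sub>0 'a::field)"
proof (cases "\<alpha> = 0")
  case True
  show ?thesis by (rule product_vector_nonzero[of 1 n 3 _ Neg]) (use assms True in auto)
next
  case False
  show ?thesis by (rule product_vector_nonzero[of 1 n 3 _ Pos]) (use assms False in auto)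
qed

text \<open>A common eigenvector of \<open>S\<^sub>i\<close> and \<open>S\<^sub>i\<^sub>-\<^sub>1\<close> with eigenvalues \<open>A\<close> and \<open>B\<close> is an eigenvector of \<open>e\<^sub>i\<close> with eigenvalue
\<open>A \<sigma> - B \<tau>\<close>.\<close>

lemma spectrum_idem_lower:
  fixes \<alpha> \<sigma> \<tau> :: "'a::field"
  assumes two: "(2::'a) \<noteq> 0" and mn: "Suc m < n" "3 \<le> m"
    and \<sigma>: "\<sigma> * (1 + \<alpha> * of_nat m) = 1" and \<tau>: "\<tau> * (1 + \<alpha> * (of_nat m - 1)) = 1"
  shows "{1, 0, \<alpha> / 2 * \<sigma> * (of_nat m + 2), 1 - \<alpha> / 2 * \<tau> * (of_nat m + 1),
      \<alpha> / 2 * \<sigma> * (of_nat m + 2) - \<alpha> / 2 * \<tau> * (of_nat m + 1),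
      \<alpha> * \<sigma> * (of_nat m + 1) - \<alpha> / 2 * \<tau> * (of_nat m + 1),
      \<alpha> * \<sigma> * (of_nat m + 1) - \<alpha> * \<tau> * of_nat m} \<subseteq>
    Spec \<alpha> (double_A n) (scale \<sigma> (point_sum (plus_points (Suc m))) - scale \<tau> (point_sum (plus_points m)))"
proof -
  define E where "E = scale \<sigma> (point_sum (plus_points (Suc m))) - scale \<tau> (point_sum (plus_points m))"
  let ?S = "\<lambda>j. matsuo_mult \<alpha> (double_A n) (point_sum (plus_points j))"
  let ?s = "1 + \<alpha> * of_nat m" and ?t = "1 + \<alpha> * (of_nat m - 1)"
  have le: "Suc m \<le> n" "m \<le> n" "1 \<le> m" "1 \<le> Suc m" using mn by simp_all
  have joint: "\<mu> \<in> Spec \<alpha> (double_A n) E"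
    if "v \<in> matsuo_carrier (double_A n)" "v \<noteq> 0" "?S (Suc m) v = scale A v" "?S m v = scale B v"
      "\<mu> = A * \<sigma> - B * \<tau>" for A B \<mu> v
  proof (rule SpecI[OF that(1,2)])
    show "matsuo_mult \<alpha> (double_A n) E v = scale \<mu> v"
      unfolding E_def matsuo_mult_diff_scale_left that(3-5)
      by (simp add: free.scale_left_diff_distrib mult.commute)
  qed
  have span_m: "point_sum (plus_points m) \<in> free.span (pt ` plus_points (Suc m))"
    using span_plus_points_mono[OF _ point_sum_in_span_plus, of m "Suc m"] by simp
  have SS: "?S (Suc m) (point_sum (plus_points m)) = scale ?s (point_sum (plus_points m))"
    "?S m (point_sum (plus_points m)) = scale ?t (point_sum (plus_points m))"
    using plus_points_mult_span[OF two le(4,1) span_m, of \<alpha>]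
      plus_points_mult_span[OF two le(3,2) point_sum_in_span_plus, of \<alpha>] by simp_all
  have E_span: "E \<in> free.span (pt ` plus_points (Suc m))"
    unfolding E_def by (intro free.span_diff free.span_scale point_sum_in_span_plus span_m)
  have E_car: "E \<in> matsuo_carrier (double_A n)"
    using span_plus_points_mono[OF le(1) E_span] span_plus_points_carrier by blast
  have one: "1 \<in> Spec \<alpha> (double_A n) E"
  proof (rule joint[OF E_car])
    have p: "(transpose 1 (m + 2), Pos) \<in> plus_points (Suc m)" "(transpose 1 (m + 2), Pos) \<notin> plus_points m"
      by (auto simp: plus_points_def transpose_in_points_iff)
    then have "coord E (transpose 1 (m + 2), Pos) = \<sigma>"
      unfolding E_def lookup_minus lookup_scale
      by (simp add: lookup_point_sum finite_plus_points)
    then show "E \<noteq> 0" using \<sigma> by auto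
    show "?S (Suc m) E = scale ?s E"
      using plus_points_mult_span[OF two le(4,1) E_span, of \<alpha>] by simp
    have "?S m E = matsuo_mult \<alpha> (double_A n) E (point_sum (plus_points m))"
      by (rule triple_system.matsuo_mult_commute[OF triple_system_double_A])
    also have "\<dots> = scale (\<sigma> * ?s) (point_sum (plus_points m)) - scale (\<tau> * ?t) (point_sum (plus_points m))"
      unfolding E_def matsuo_mult_diff_scale_left SS free.scale_scale ..
    finally show "?S m E = scale 0 E" unfolding \<sigma> \<tau> by simp
    show "1 = ?s * \<sigma> - 0 * \<tau>" using \<sigma> by (simp add: mult.commute)
  qed
  have zero: "0 \<in> Spec \<alpha> (double_A n) E"
  proof (rule joint[OF _ _ SS])
    show "point_sum (plus_points m) \<in> matsuo_carrier (double_A n)" by (rule point_sum_in_carrier[OF le(2)])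
    have "(transpose 1 2, Pos) \<in> plus_points m"
      using le by (auto simp: plus_points_def transpose_in_points_iff)
    then show "point_sum (plus_points m) \<noteq> (0 :: _ \<Rightarrow>\<^sub>0 'a)"
      using lookup_point_sum[OF finite_plus_points, of m] by (metis lookup_zero zero_neq_one)
    show "0 = ?s * \<sigma> - ?t * \<tau>" using \<sigma> \<tau> by (simp add: mult.commute)
  qed
  \<comment> \<open>The star of the letter \<open>m + 3\<close>, which exists because of \<open>i < n\<close>.  The values of \<open>h\<close> add up
    to zero on \<open>\<A>\<^sub>i\<close>, and \<open>h\<close> is constant on \<open>\<A>\<^sub>i\<^sub>-\<^sub>1\<close>.\<close>
  have eta: "\<alpha> / 2 * \<sigma> * (of_nat m + 2) \<in> Spec \<alpha> (double_A n) E"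
  proof -
    define h where "h = (\<lambda>x. if x \<in> {1..m + 1} then 1 else if x = m + 2 then - (of_nat m + 1) else 0 :: 'a)"
    have H: "sum h (letters m) = of_nat m + 1" "sum h (letters (Suc m)) = 0"
      by (rule trans[OF sum_two_level(1)[OF _ _ h_def]] trans[OF sum_two_level(2)[OF _ _ h_def]];
          use mn le in simp)+
    show ?thesis
    proof (rule joint[where A = "\<alpha> / 2 * (of_nat m + 2)" and B = 0, OF product_vector_in_carrier])
      show "product_vector n (sign_fun 1 (- 1)) (\<lambda>x. if x = m + 3 then 1 else 0) h \<noteq> 0"
        by (rule product_vector_nonzero[of 1 n "m + 3" _ Pos]) (use mn in \<open>auto simp: h_def\<close>)
      show "?S (Suc m) (product_vector n (sign_fun 1 (- 1)) (\<lambda>x. if x = m + 3 then 1 else 0) h) =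
          scale (\<alpha> / 2 * (of_nat m + 2)) (product_vector n (sign_fun 1 (- 1)) (\<lambda>x. if x = m + 3 then 1 else 0) h)"
      proof (rule eigenvector_outside[OF two le(1)])
        fix d
        show "\<alpha> / 2 * ((of_nat (Suc m) + 1) * h d - sum h (letters (Suc m))) = \<alpha> / 2 * (of_nat m + 2) * h d"
          unfolding H by (simp add: add.commute)
        assume "d \<notin> letters (Suc m)"
        then have "h d = 0" by (auto simp: h_def)
        then show "\<alpha> / 2 * (of_nat m + 2) * h d = 0" by simp
      qed (use mn in \<open>auto simp: h_def\<close>)
      show "?S m (product_vector n (sign_fun 1 (- 1)) (\<lambda>x. if x = m + 3 then 1 else 0) h) =
          scale 0 (product_vector n (sign_fun 1 (- 1)) (\<lambda>x. if x = m + 3 then 1 else 0) h)"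
      proof (rule eigenvector_outside[OF two le(2)])
        fix d assume "d \<in> letters m"
        then have "h d = 1" by (simp add: h_def)
        then show "\<alpha> / 2 * ((of_nat m + 1) * h d - sum h (letters m)) = 0 * h d"
          unfolding H by simp
      qed (use mn in \<open>auto simp: h_def\<close>)
    qed (simp add: algebra_simps)
  qed
  have eta_diff: "\<alpha> / 2 * \<sigma> * (of_nat m + 2) - \<alpha> / 2 * \<tau> * (of_nat m + 1) \<in> Spec \<alpha> (double_A n) E"
  proof -
    define h where "h = (difference_12 :: nat \<Rightarrow> 'a)"
    have H: "sum h (letters m) = 0" "sum h (letters (Suc m)) = 0"
      unfolding h_def using le by (intro sum_difference_12, simp)+
    have v: "?S j (product_vector n (sign_fun 1 (- 1)) (\<lambda>x. if x = m + 3 then 1 else 0) h) =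
          scale (\<alpha> / 2 * (of_nat j + 1)) (product_vector n (sign_fun 1 (- 1)) (\<lambda>x. if x = m + 3 then 1 else 0) h)"
      if "j = m \<or> j = Suc m" for j
    proof (rule eigenvector_outside[OF two])
      have Hj: "sum h (letters j) = 0" using that H by blast
      show "\<alpha> / 2 * ((of_nat j + 1) * h d - sum h (letters j)) = \<alpha> / 2 * (of_nat j + 1) * h d" for d
        unfolding Hj by simp
    qed (use mn that in \<open>auto simp: h_def\<close>)
    show ?thesis
    proof (rule joint[OF product_vector_in_carrier _ v v])
      show "product_vector n (sign_fun 1 (- 1)) (\<lambda>x. if x = m + 3 then 1 else 0) h \<noteq> 0"
        by (rule product_vector_nonzero[of 1 n "m + 3" _ Pos]) (use mn in \<open>auto simp: h_def\<close>)
    qed (auto simp: algebra_simps)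
  qed
  \<comment> \<open>Positive edges: \<open>(1, m + 2) - (2, m + 2)\<close> is an eigenvector of \<open>S\<^sub>i\<^sub>-\<^sub>1\<close> up to a
    correction in \<open>\<A>\<^sub>i\<^sub>-\<^sub>1\<close>.  Scaling by \<open>w\<close> clears the denominator of the correction.\<close>
  have one_eta: "1 - \<alpha> / 2 * \<tau> * (of_nat m + 1) \<in> Spec \<alpha> (double_A n) E"
  proof -
    define \<beta> where "\<beta> = \<alpha> / 2"
    have \<alpha>: "\<alpha> = 2 * \<beta>" "\<alpha> / 2 = \<beta>" using two by (simp_all add: \<beta>_def)
    define w where "w = \<beta> * (of_nat m + 1) - ?t"
    define h where "h = (\<lambda>x. if x \<in> {3..m + 1} then \<beta> else if x = m + 2 then w else 0)"
    have H: "sum h (letters m) = (of_nat m - 1) * \<beta>" "sum h (letters (Suc m)) = (of_nat m - 1) * \<beta> + w"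
      "sum h (letters n) = (of_nat m - 1) * \<beta> + w"
      by (rule trans[OF sum_two_level(1)[OF _ _ h_def]] trans[OF sum_two_level(2)[OF _ _ h_def]];
          use mn le in simp)+
    let ?v = "product_vector n (sign_fun 1 0) difference_12 h"
    have "\<beta> \<noteq> 0 \<or> w \<noteq> 0"
    proof (rule ccontr)
      assume "\<not> (\<beta> \<noteq> 0 \<or> w \<noteq> 0)"
      then have "?t = 0" by (simp add: w_def)
      then show False using \<tau> by simp
    qed
    then have nz: "?v \<noteq> 0"
    proof
      assume "\<beta> \<noteq> 0"
      then show ?thesis by (intro product_vector_nonzero[of 1 n 3 _ Pos]) (use mn in \<open>auto simp: h_def\<close>)
    next
      assume "w \<noteq> 0"
      then show ?thesis by (intro product_vector_nonzero[of 1 n "m + 2" _ Pos]) (use mn in \<open>auto simp: h_def\<close>)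
    qed
    have out: "h d = 0" if "d \<in> letters n - letters (Suc m)" for d using that by (auto simp: h_def)
    have v1: "?S (Suc m) ?v = scale ?s ?v"
    proof (rule eigenvector_inside[OF two le(1,4)])
      fix d
      show "d \<in> letters n - letters (Suc m) \<Longrightarrow> \<alpha> / 2 * (of_nat (Suc m) + 1) * h d = ?s * h d"
        using out by simp
    qed (unfold H sign_fun_simps, use mn in \<open>auto simp: h_def algebra_simps\<close>)
    have v2: "?S m ?v = scale (\<beta> * (of_nat m + 1)) ?v"
    proof (rule eigenvector_inside[OF two le(2,3)])
      fix d
      show "d \<in> letters n - letters m \<Longrightarrow> \<alpha> / 2 * (of_nat m + 1) * h d = \<beta> * (of_nat m + 1) * h d"
        unfolding \<alpha>(2) ..
      assume "d \<in> letters m - {1, 2}"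
      then have d: "h d = \<beta>" using mn by (auto simp: h_def)
      show "sign_fun 1 0 Pos * (\<alpha> * of_nat m * h d - \<alpha> / 2 * sum h (letters m)) +
         ((1 - \<alpha>) * sign_fun 1 0 Pos - \<alpha> * sign_fun 1 0 Neg) * h d +
         \<alpha> / 2 * (sign_fun 1 0 Pos + sign_fun 1 0 Neg) * sum h (letters n) =
         \<beta> * (of_nat m + 1) * (sign_fun 1 0 Pos * h d)"
        unfolding H d sign_fun_simps \<alpha>(2) w_def unfolding \<alpha>(1) by (simp add: algebra_simps)
    qed (use mn in \<open>simp_all add: h_def\<close>)
    show ?thesis
      by (rule joint[OF product_vector_in_carrier nz v1 v2]) (use \<sigma> \<alpha>(2) in \<open>simp add: mult_ac\<close>)
  qed
  \<comment> \<open>The value \<open>m - 1\<close> at \<open>m + 2\<close> makes all row sums over \<open>\<A>\<^sub>i\<close> vanish, as in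
    \<open>eigenvector_difference_34\<close>, but not those over \<open>\<A>\<^sub>i\<^sub>-\<^sub>1\<close>.\<close>
  have hat_eta: "\<alpha> * \<sigma> * (of_nat m + 1) - \<alpha> / 2 * \<tau> * (of_nat m + 1) \<in> Spec \<alpha> (double_A n) E"
  proof -
    define \<beta> where "\<beta> = \<alpha> / 2"
    have \<alpha>: "\<alpha> = 2 * \<beta>" "\<alpha> / 2 = \<beta>" using two by (simp_all add: \<beta>_def)
    define h where "h = (\<lambda>x. if x \<in> {3..m + 1} then - 1 else if x = m + 2 then of_nat m - 1 else 0 :: 'a)"
    have H: "sum h (letters m) = - (of_nat m - 1)" "sum h (letters (Suc m)) = 0" "sum h (letters n) = 0"
      by (rule trans[OF sum_two_level(1)[OF _ _ h_def]] trans[OF sum_two_level(2)[OF _ _ h_def]];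
          use mn le in simp)+
    let ?v = "product_vector n (sign_fun \<alpha> (1 - \<alpha>)) difference_12 h"
    have nz: "?v \<noteq> 0"
    proof (cases "\<alpha> = 0")
      case True
      show ?thesis by (rule product_vector_nonzero[of 1 n 3 _ Neg]) (use mn True in \<open>auto simp: h_def\<close>)
    next
      case False
      show ?thesis by (rule product_vector_nonzero[of 1 n 3 _ Pos]) (use mn False in \<open>auto simp: h_def\<close>)
    qed
    have out: "h d = 0" if "d \<in> letters n - letters (Suc m)" for d using that by (auto simp: h_def)
    have v1: "?S (Suc m) ?v = scale (\<alpha> * (of_nat m + 1)) ?v"
    proof (rule eigenvector_inside[OF two le(1,4)])
      fix d
      show "d \<in> letters n - letters (Suc m) \<Longrightarrow> \<alpha> / 2 * (of_nat (Suc m) + 1) * h d = \<alpha> * (of_nat m + 1) * h d"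
        using out by simp
    qed (unfold H sign_fun_simps, use mn in \<open>auto simp: h_def algebra_simps\<close>)
    have v2: "?S m ?v = scale (\<beta> * (of_nat m + 1)) ?v"
    proof (rule eigenvector_inside[OF two le(2,3)])
      fix d
      show "d \<in> letters n - letters m \<Longrightarrow> \<alpha> / 2 * (of_nat m + 1) * h d = \<beta> * (of_nat m + 1) * h d"
        unfolding \<alpha>(2) ..
      assume "d \<in> letters m - {1, 2}"
      then have d: "h d = - 1" using mn by (auto simp: h_def)
      show "sign_fun \<alpha> (1 - \<alpha>) Pos * (\<alpha> * of_nat m * h d - \<alpha> / 2 * sum h (letters m)) +
         ((1 - \<alpha>) * sign_fun \<alpha> (1 - \<alpha>) Pos - \<alpha> * sign_fun \<alpha> (1 - \<alpha>) Neg) * h d +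
         \<alpha> / 2 * (sign_fun \<alpha> (1 - \<alpha>) Pos + sign_fun \<alpha> (1 - \<alpha>) Neg) * sum h (letters n) =
         \<beta> * (of_nat m + 1) * (sign_fun \<alpha> (1 - \<alpha>) Pos * h d)"
        unfolding H d sign_fun_simps \<alpha>(2) unfolding \<alpha>(1) by (simp add: algebra_simps)
      show "sign_fun \<alpha> (1 - \<alpha>) Neg * (\<alpha> * of_nat m * h d - \<alpha> / 2 * sum h (letters m)) =
         \<beta> * (of_nat m + 1) * (sign_fun \<alpha> (1 - \<alpha>) Neg * h d)"
        unfolding H d sign_fun_simps \<alpha>(2) unfolding \<alpha>(1) by (simp add: algebra_simps)
    qed (use mn in \<open>simp_all add: h_def\<close>)
    show ?thesis
      by (rule joint[OF product_vector_in_carrier nz v1 v2]) (simp add: \<alpha>(2) mult_ac)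
  qed
  have hat_diff: "\<alpha> * \<sigma> * (of_nat m + 1) - \<alpha> * \<tau> * of_nat m \<in> Spec \<alpha> (double_A n) E"
    by (rule joint[OF product_vector_in_carrier difference_34_nonzero
          eigenvector_difference_34[OF two le(1)] eigenvector_difference_34[OF two le(2)]])
       (use mn in \<open>simp_all add: algebra_simps\<close>)
  show ?thesis
    using one zero eta eta_diff one_eta hat_eta hat_diff unfolding E_def by blast
qed

lemma spectrum_idem:
  fixes \<alpha> \<sigma> \<tau> :: "'a::field"
  assumes two: "(2::'a) \<noteq> 0" and mn: "Suc m < n" "3 \<le> m"
    and \<sigma>: "\<sigma> * (1 + \<alpha> * of_nat m) = 1" and \<tau>: "\<tau> * (1 + \<alpha> * (of_nat m - 1)) = 1"
  shows "Spec \<alpha> (double_A n) (scale \<sigma> (point_sum (plus_points (Suc m))) - scale \<tau> (point_sum (plus_points m))) =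
    {1, 0, \<alpha> / 2 * \<sigma> * (of_nat m + 2), 1 - \<alpha> / 2 * \<tau> * (of_nat m + 1),
      \<alpha> / 2 * \<sigma> * (of_nat m + 2) - \<alpha> / 2 * \<tau> * (of_nat m + 1),
      \<alpha> * \<sigma> * (of_nat m + 1) - \<alpha> / 2 * \<tau> * (of_nat m + 1),
      \<alpha> * \<sigma> * (of_nat m + 1) - \<alpha> * \<tau> * of_nat m}" (is "?Spec = ?R")
proof (rule antisym)
  show "?R \<subseteq> ?Spec" by (rule spectrum_idem_lower[OF assms])
  have le: "Suc m \<le> n" "1 \<le> m" using mn by simp_all
  show "?Spec \<subseteq> ?R"
  proof
    fix k assume "k \<in> ?Spec"
    then obtain v where v: "v \<in> matsuo_carrier (double_A n)" "v \<noteq> 0"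
      and eq: "matsuo_mult \<alpha> (double_A n)
        (scale \<sigma> (point_sum (plus_points (Suc m))) - scale \<tau> (point_sum (plus_points m))) v = scale k v"
      unfolding Spec_def by blast
    show "k \<in> ?R"
    proof (rule ccontr)
      assume "k \<notin> ?R"
      then show False using spectrum_idem_upper[OF two le \<sigma> \<tau> v(1) eq] v(2) by simp
    qed
  qed
qed

section \<open>The spectrum of the difference of the double and the simple identity\<close>

lemma double_points_mult:
  fixes \<alpha> :: "'a::field"
  assumes "(2::'a) \<noteq> 0" "1 \<le> n" "v \<in> matsuo_carrier (double_A n)"
  shows "matsuo_mult \<alpha> (double_A n) (point_sum (points (double_A n))) v = scale (1 + 2 * \<alpha> * (of_nat n - 1)) v"
proof -
  have "\<alpha> / 2 * of_nat (4 * (n - 1)) = 2 * \<alpha> * (of_nat n - 1)"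
    using assms(1,2) by (simp add: of_nat_diff field_simps)
  then show ?thesis
    using regular_subsystem.point_sum_mult[OF regular_double_points[OF assms(2) order.refl], of v \<alpha>] assms(3)
    by (simp add: span_pt_image matsuo_carrier_def)
qed

lemma idem_hat_mult:
  fixes \<alpha> \<rho> \<sigma> :: "'a::field"
  assumes "(2::'a) \<noteq> 0" "1 \<le> n" "\<rho> * (1 + 2 * \<alpha> * (of_nat n - 1)) = 1" "v \<in> matsuo_carrier (double_A n)"
  shows "matsuo_mult \<alpha> (double_A n)
      (scale \<rho> (point_sum (points (double_A n))) - scale \<sigma> (point_sum (plus_points n))) v =
    v - scale \<sigma> (matsuo_mult \<alpha> (double_A n) (point_sum (plus_points n)) v)"
  unfolding matsuo_mult_diff_scale_left double_points_mult[OF assms(1,2,4)] free.scale_scale assms(3) by simp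

text \<open>The identity of the double fixes every vector, which leaves \<open>1\<close> minus the action of \<open>\<sigma> S\<^sub>n\<close>.  There are no outer
letters any more: the equations for the row sums, and the total of the row sums before them, only concern the negative edges.\<close>

lemma spectrum_idem_hat_upper:
  fixes \<alpha> \<sigma> k :: "'a::field"
  assumes two: "(2::'a) \<noteq> 0" and n: "1 \<le> n"
    and \<sigma>: "\<sigma> * (1 + \<alpha> * (of_nat n - 1)) = 1"
    and v: "v \<in> matsuo_carrier (double_A n)"
    and eq: "v - scale \<sigma> (matsuo_mult \<alpha> (double_A n) (point_sum (plus_points n)) v) = scale k v"
    and k: "k \<noteq> 1" "k \<noteq> 0" "k \<noteq> 1 - \<alpha> / 2 * \<sigma> * (of_nat n + 1)" "k \<noteq> 1 - \<alpha> * \<sigma> * of_nat n"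
  shows "v = 0"
proof -
  let ?S = "matsuo_mult \<alpha> (double_A n) (point_sum (plus_points n)) v"
  define \<beta> where "\<beta> = \<alpha> / 2"
  have \<alpha>: "\<alpha> / 2 = \<beta>" "\<alpha> = 2 * \<beta>" using two by (simp_all add: \<beta>_def)
  have coords: "k * coord v p = coord v p - \<sigma> * coord ?S p" for p
    using arg_cong[OF eq, of "\<lambda>w. coord w p"] unfolding lookup_minus lookup_scale by simp
  define c where "c a b = coord v (transpose a b, Neg)" for a b
  have c_self: "c a a = 0" for a unfolding c_def by (rule coord_transpose_self[OF v])
  define C where "C a = sum (c a) (letters n)" for a
  define F where "F = sum C (letters n)"
  have row: "row_sum v Neg (letters n) a = C a" for a unfolding row_sum_def c_def C_def ..
  have eq_c: "k * c a b = c a b - \<sigma> * (\<alpha> * of_nat n * c a b - \<beta> * (C a + C b))"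
    if ab: "a \<in> letters n" "b \<in> letters n" "a \<noteq> b" for a b
    unfolding c_def[of a b] coords coord_mult_inside[OF two v order.refl ab] row \<alpha>(1) by simp
  have eq_C: "k * C a = C a - \<sigma> * \<beta> * ((of_nat n + 1) * C a - F)" if a: "a \<in> letters n" for a
  proof -
    have rem: "sum g (letters n - {a}) = sum g (letters n) - g a" for g :: "nat \<Rightarrow> 'a"
      using a by (simp add: sum_diff1)
    have cnt: "(\<Sum>b\<in>letters n - {a}. x) = of_nat n * x" for x :: 'a
      unfolding rem by (simp add: algebra_simps)
    have "k * C a = (\<Sum>b\<in>letters n - {a}. k * c a b)"
      unfolding sum_distrib_left[symmetric] rem c_self C_def by simp
    also have "\<dots> = (\<Sum>b\<in>letters n - {a}. c a b - \<sigma> * (\<alpha> * of_nat n * c a b - \<beta> * (C a + C b)))"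
      using eq_c[OF a] by (intro sum.cong) auto
    also have "\<dots> = C a - \<sigma> * (\<alpha> * of_nat n * C a - \<beta> * (of_nat n * C a + (F - C a)))"
      unfolding sum_subtractf sum_distrib_left[symmetric] sum.distrib cnt
      unfolding rem c_self C_def[symmetric] F_def by simp
    finally show ?thesis unfolding \<alpha>(2) by (simp add: algebra_simps)
  qed
  have "k * F = (\<Sum>a\<in>letters n. C a - \<sigma> * \<beta> * ((of_nat n + 1) * C a - F))"
    unfolding F_def sum_distrib_left using eq_C[unfolded F_def] by (rule sum.cong[OF refl])
  also have "\<dots> = F - \<sigma> * \<beta> * ((of_nat n + 1) * F - (of_nat n + 1) * F)"
    unfolding sum_subtractf sum_distrib_left[symmetric] F_def[symmetric] by (simp add: algebra_simps)
  finally have F0: "F = 0" using k(1) by simp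
  have C0: "C a = 0" if "a \<in> letters n" for a
  proof -
    have "(k - (1 - \<beta> * \<sigma> * (of_nat n + 1))) * C a = 0"
      using eq_C[OF that] F0 by (simp add: algebra_simps)
    then show ?thesis using k(3) \<alpha>(1) by simp
  qed
  have c0: "c a b = 0" if ab: "a \<in> letters n" "b \<in> letters n" "a \<noteq> b" for a b
  proof -
    have "(k - (1 - \<alpha> * \<sigma> * of_nat n)) * c a b = 0"
      using eq_c[OF ab] C0[OF ab(1)] C0[OF ab(2)] by (simp add: algebra_simps)
    then show ?thesis using k(4) by simp
  qed
  have "coord v p = 0" if p: "p \<notin> plus_points n" for p
  proof (cases "p \<in> points (double_A n)")
    case True
    then obtain a b s where p': "p = (transpose a b, s)" "a \<in> letters n" "b \<in> letters n" "a \<noteq> b"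
      by (cases p) (auto simp: points_double_A points_fischer_A)
    then have "s \<noteq> Pos" using p by (auto simp: plus_points_def transpose_in_points_iff)
    then have "s = Neg" by (cases s) auto
    then show ?thesis using c0[OF p'(2-4)] unfolding p'(1) c_def by simp
  qed (use v in \<open>auto simp: matsuo_carrier_def in_keys_iff\<close>)
  then have "v \<in> free.span (pt ` plus_points n)"
    by (auto simp: span_pt_image in_keys_iff)
  then have "?S = scale (1 + \<alpha> * (of_nat n - 1)) v"
    by (rule plus_points_mult_span[OF two n order.refl])
  then have "k * coord v p = 0" for p
    using coords[of p] \<sigma> by (simp add: mult.assoc[symmetric])
  then show "v = 0" using k(2) by (intro poly_mapping_eqI) simp
qed

lemma spectrum_idem_hat_lower:
  fixes \<alpha> \<rho> \<sigma> :: "'a::field"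
  assumes two: "(2::'a) \<noteq> 0" and n: "3 \<le> n"
    and \<sigma>: "\<sigma> * (1 + \<alpha> * (of_nat n - 1)) = 1"
    and \<rho>: "\<rho> * (1 + 2 * \<alpha> * (of_nat n - 1)) = 1"
  shows "{1, 0, 1 - \<alpha> / 2 * \<sigma> * (of_nat n + 1), 1 - \<alpha> * \<sigma> * of_nat n} \<subseteq>
    Spec \<alpha> (double_A n) (scale \<rho> (point_sum (points (double_A n))) - scale \<sigma> (point_sum (plus_points n)))"
proof -
  define E where "E = scale \<rho> (point_sum (points (double_A n))) - scale \<sigma> (point_sum (plus_points n))"
  let ?S = "matsuo_mult \<alpha> (double_A n) (point_sum (plus_points n))"
  let ?s = "1 + \<alpha> * (of_nat n - 1)"
  have n1: "1 \<le> n" using n by simp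
  have E_mult: "matsuo_mult \<alpha> (double_A n) E v = v - scale \<sigma> (?S v)" if "v \<in> matsuo_carrier (double_A n)" for v
    unfolding E_def by (rule idem_hat_mult[OF two n1 \<rho> that])
  have joint: "1 - A * \<sigma> \<in> Spec \<alpha> (double_A n) E"
    if "v \<in> matsuo_carrier (double_A n)" "v \<noteq> 0" "?S v = scale A v" for A v
    by (rule SpecI[OF that(1,2)])
       (simp add: E_mult[OF that(1)] that(3) free.scale_left_diff_distrib mult.commute)
  have P: "point_sum (plus_points n) \<in> matsuo_carrier (double_A n)" by (rule point_sum_in_carrier[OF order.refl])
  have PP: "?S (point_sum (plus_points n)) = scale ?s (point_sum (plus_points n))"
    by (rule plus_points_mult_span[OF two n1 order.refl point_sum_in_span_plus])
  have fin: "finite (points (double_A n))"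
    by (rule triple_system.finite_points[OF triple_system_double_A])
  have E_car: "E \<in> matsuo_carrier (double_A n)"
    using P keys_diff_scale_subset[of \<rho> "point_sum (points (double_A n))" \<sigma> "point_sum (plus_points n)"]
    unfolding E_def matsuo_carrier_def by (auto simp: keys_point_sum[OF fin])
  have t12: "transpose 1 2 \<in> points (fischer_A n)"
    using n1 by (simp add: transpose_in_points_iff)
  have one: "1 \<in> Spec \<alpha> (double_A n) E"
  proof -
    have "(transpose 1 2, Neg) \<notin> plus_points n" by (simp add: plus_points_def)
    then have "coord E (transpose 1 2, Neg) = \<rho>"
      unfolding E_def lookup_minus lookup_scale lookup_point_sum[OF fin] lookup_point_sum[OF finite_plus_points]
      using t12 by (simp add: points_double_A)
    then have nz: "E \<noteq> 0" using \<rho> by auto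
    have "?S E = matsuo_mult \<alpha> (double_A n) E (point_sum (plus_points n))"
      by (rule triple_system.matsuo_mult_commute[OF triple_system_double_A])
    also have "\<dots> = point_sum (plus_points n) - scale (\<sigma> * ?s) (point_sum (plus_points n))"
      unfolding E_mult[OF P] PP free.scale_scale ..
    finally have "?S E = scale 0 E" unfolding \<sigma> by simp
    from joint[OF E_car nz this] show ?thesis by simp
  qed
  have zero: "0 \<in> Spec \<alpha> (double_A n) E"
  proof -
    have "(transpose 1 2, Pos) \<in> plus_points n" using t12 by (simp add: plus_points_def)
    then have "point_sum (plus_points n) \<noteq> (0 :: _ \<Rightarrow>\<^sub>0 'a)"
      using lookup_point_sum[OF finite_plus_points, of n] by (metis lookup_zero zero_neq_one)
    from joint[OF P this PP] show ?thesis using \<sigma> by (simp add: mult.commute)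
  qed
  have one_eta: "1 - \<alpha> / 2 * \<sigma> * (of_nat n + 1) \<in> Spec \<alpha> (double_A n) E"
  proof -
    define \<beta> where "\<beta> = \<alpha> / 2"
    have \<alpha>: "\<alpha> = 2 * \<beta>" "\<alpha> / 2 = \<beta>" using two by (simp_all add: \<beta>_def)
    \<comment> \<open>For this \<open>h\<close> the negative edges have eigenvalue \<open>\<beta> (n + 1)\<close> up to multiples of the positive
      ones; the coefficient \<open>p\<close> corrects this.  Since \<open>p + (1 - p) = 1\<close>, the vector is not zero.\<close>
    define p where "p = - (\<beta> * (of_nat n - 3))"
    define h where "h = (\<lambda>x. if x \<in> {3..n + 1} then 1 else if x = n + 2 then 0 else 0 :: 'a)"
    have H: "sum h (letters n) = of_nat n - 1"
      by (rule trans[OF sum_two_level(1)[OF _ _ h_def]]; use n in simp)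
    let ?v = "product_vector n (sign_fun p (1 - p)) difference_12 h"
    have h3: "h 3 = 1" using n by (simp add: h_def)
    have nz: "?v \<noteq> 0"
    proof (cases "p = 0")
      case True
      show ?thesis by (rule product_vector_nonzero[of 1 n 3 _ Neg]) (use n True h3 in \<open>auto simp: h_def\<close>)
    next
      case False
      show ?thesis by (rule product_vector_nonzero[of 1 n 3 _ Pos]) (use n False h3 in \<open>auto simp: h_def\<close>)
    qed
    have "?S ?v = scale (\<beta> * (of_nat n + 1)) ?v"
    proof (rule eigenvector_inside[OF two order.refl n1])
      fix d assume "d \<in> letters n - {1, 2}"
      then have d: "h d = 1" by (auto simp: h_def)
      show "sign_fun p (1 - p) Neg * (\<alpha> * of_nat n * h d - \<alpha> / 2 * sum h (letters n)) =
         \<beta> * (of_nat n + 1) * (sign_fun p (1 - p) Neg * h d)"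
        unfolding H d sign_fun_simps \<alpha>(2) unfolding \<alpha>(1) by (simp add: algebra_simps)
      show "sign_fun p (1 - p) Pos * (\<alpha> * of_nat n * h d - \<alpha> / 2 * sum h (letters n)) +
         ((1 - \<alpha>) * sign_fun p (1 - p) Pos - \<alpha> * sign_fun p (1 - p) Neg) * h d +
         \<alpha> / 2 * (sign_fun p (1 - p) Pos + sign_fun p (1 - p) Neg) * sum h (letters n) =
         \<beta> * (of_nat n + 1) * (sign_fun p (1 - p) Pos * h d)"
        unfolding H d sign_fun_simps \<alpha>(2) p_def unfolding \<alpha>(1) by (simp add: algebra_simps)
    qed (simp_all add: h_def)
    from joint[OF product_vector_in_carrier nz this] show ?thesis unfolding \<alpha>(2) by (simp add: mult_ac)
  qed
  have one_hat: "1 - \<alpha> * \<sigma> * of_nat n \<in> Spec \<alpha> (double_A n) E"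
    using joint[OF product_vector_in_carrier difference_34_nonzero[OF n] eigenvector_difference_34[OF two order.refl n]]
    by (simp add: mult_ac)
  show ?thesis using one zero one_eta one_hat unfolding E_def by blast
qed

lemma spectrum_idem_hat:
  fixes \<alpha> \<rho> \<sigma> :: "'a::field"
  assumes two: "(2::'a) \<noteq> 0" and n: "3 \<le> n"
    and \<sigma>: "\<sigma> * (1 + \<alpha> * (of_nat n - 1)) = 1"
    and \<rho>: "\<rho> * (1 + 2 * \<alpha> * (of_nat n - 1)) = 1"
  shows "Spec \<alpha> (double_A n) (scale \<rho> (point_sum (points (double_A n))) - scale \<sigma> (point_sum (plus_points n))) =
    {1, 0, 1 - \<alpha> / 2 * \<sigma> * (of_nat n + 1), 1 - \<alpha> * \<sigma> * of_nat n}" (is "?Spec = ?R")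
proof (rule antisym)
  show "?R \<subseteq> ?Spec" by (rule spectrum_idem_hat_lower[OF assms])
  have n1: "1 \<le> n" using n by simp
  show "?Spec \<subseteq> ?R"
  proof
    fix k assume "k \<in> ?Spec"
    then obtain v where v: "v \<in> matsuo_carrier (double_A n)" "v \<noteq> 0"
      and "matsuo_mult \<alpha> (double_A n)
        (scale \<rho> (point_sum (points (double_A n))) - scale \<sigma> (point_sum (plus_points n))) v = scale k v"
      unfolding Spec_def by blast
    then have eq: "v - scale \<sigma> (matsuo_mult \<alpha> (double_A n) (point_sum (plus_points n)) v) = scale k v"
      using idem_hat_mult[OF two n1 \<rho> v(1)] by metis
    show "k \<in> ?R"
    proof (rule ccontr)
      assume "k \<notin> ?R"
      then show False using spectrum_idem_hat_upper[OF two n1 \<sigma> v(1) eq] v(2) by simp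
    qed
  qed
qed

section \<open>Identity elements and central charges\<close>

lemma half_degree:
  fixes \<alpha> :: "'a::field"
  assumes "(2::'a) \<noteq> 0" "1 \<le> j"
  shows "1 + \<alpha> / 2 * of_nat (2 * (j - 1)) = 1 + \<alpha> * (of_nat j - 1)"
    "1 + \<alpha> / 2 * of_nat (4 * (j - 1)) = 1 + 2 * \<alpha> * (of_nat j - 1)"
  using assms by (simp_all add: of_nat_diff field_simps)

lemma ident_eq:
  fixes \<alpha> :: "'a::field"
  assumes "(2::'a) \<noteq> 0" "1 \<le> j" "j \<le> n" "has_identity \<alpha> (double_A n) (sub_A j)"
  shows "ident \<alpha> n j = scale (1 / (1 + \<alpha> * (of_nat j - 1))) (point_sum (plus_points j))"
  using regular_subsystem.the_identity_eq(2)[OF regular_plus_points[OF assms(2,3)] assms(4)[unfolded sub_A_eq_span]]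
  unfolding ident_def sub_A_eq_span half_degree[OF assms(1,2)] .

lemma ident_hat_eq:
  fixes \<alpha> :: "'a::field"
  assumes "(2::'a) \<noteq> 0" "1 \<le> j" "j \<le> n" "has_identity \<alpha> (double_A n) (sub_A_double j)"
  shows "1 + 2 * \<alpha> * (of_nat j - 1) \<noteq> 0"
    and "ident_hat \<alpha> n j = scale (1 / (1 + 2 * \<alpha> * (of_nat j - 1))) (point_sum (points (double_A j)))"
  using regular_subsystem.the_identity_eq[OF regular_double_points[OF assms(2,3)] assms(4)[unfolded sub_A_double_def]]
  unfolding ident_hat_def sub_A_double_def half_degree[OF assms(1,2)] .

lemma twice_card_plus_points: "2 * of_nat (card (plus_points j)) = (of_nat j * (of_nat j + 1) :: 'a::field)"
proof -
  have "card (plus_points j) = card (points (fischer_A j))"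
    unfolding plus_points_def by (simp add: card_cartesian_product)
  then have "2 * card (plus_points j) = j * (j + 1)" using card_points_fischer_A by simp
  from arg_cong[OF this, of "of_nat :: nat \<Rightarrow> 'a"] show ?thesis
    by (simp add: algebra_simps)
qed

lemma card_double_points: "card (points (double_A j)) = 2 * card (plus_points j)"
  unfolding points_double_A_eq plus_points_def sign_UNIV by (simp add: card_cartesian_product)

text \<open>The form of two sums over nested subsystems is the size of the smaller one times the common value \<open>2 c s\<close> of the
larger one.  Multiplying with \<open>\<sigma> s = 1\<close> turns the result into \<open>c\<close> times the difference of the normalised numbers of points.\<close>

lemma central_charge_idem:
  fixes \<alpha> c \<sigma> \<tau> :: "'a::field"
  assumes two: "(2::'a) \<noteq> 0" and m: "1 \<le> m" "Suc m \<le> n"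
    and \<sigma>: "\<sigma> * (1 + \<alpha> * of_nat m) = 1" and \<tau>: "\<tau> * (1 + \<alpha> * (of_nat m - 1)) = 1"
  shows "central_charge \<alpha> c (double_A n)
      (scale \<sigma> (point_sum (plus_points (Suc m))) - scale \<tau> (point_sum (plus_points m))) =
    c / 2 * ((of_nat m + 1) * (2 + \<alpha> * (of_nat m - 2)) * (\<sigma> * \<tau>))"
proof -
  let ?f = "\<lambda>j k. matsuo_form \<alpha> c (double_A n) (point_sum (plus_points j)) (point_sum (plus_points k))"
  let ?s = "1 + \<alpha> * of_nat m" and ?t = "1 + \<alpha> * (of_nat m - 1)"
  define N where "N j = (of_nat (card (plus_points j)) :: 'a)" for j
  have le: "m \<le> n" "1 \<le> Suc m" using m by simp_all
  have sub: "plus_points m \<subseteq> plus_points (Suc m)"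
    using points_fischer_A_mono[of m "Suc m"] by (auto simp: plus_points_def)
  note big = regular_subsystem.matsuo_form_point_sum[OF regular_plus_points[OF le(2) m(2)] _ two, of _ \<alpha> c]
  note small = regular_subsystem.matsuo_form_point_sum[OF regular_plus_points[OF m(1) le(1)] order.refl two, of \<alpha> c]
  have forms: "?f (Suc m) (Suc m) = 2 * c * N (Suc m) * ?s" "?f (Suc m) m = 2 * c * N m * ?s"
    "?f m (Suc m) = 2 * c * N m * ?s" "?f m m = 2 * c * N m * ?t"
    using big(1)[OF order.refl] big(1)[OF sub] big(2)[OF sub] small(1)
    unfolding half_degree[OF two le(2)] half_degree[OF two m(1)] N_def by simp_all
  have "matsuo_form \<alpha> c (double_A n) (scale \<sigma> (point_sum (plus_points (Suc m))) - scale \<tau> (point_sum (plus_points m)))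
      (scale \<sigma> (point_sum (plus_points (Suc m))) - scale \<tau> (point_sum (plus_points m))) =
     2 * c * N (Suc m) * \<sigma> * (\<sigma> * ?s) - 2 * (2 * c * N m * \<tau>) * (\<sigma> * ?s) + 2 * c * N m * \<tau> * (\<tau> * ?t)"
    unfolding matsuo_form_diff_scale forms by (simp add: algebra_simps)
  also have "\<dots> = c * ((2 * N (Suc m)) * \<sigma> - (2 * N m) * \<tau>)"
    unfolding \<sigma> \<tau> by (simp add: algebra_simps)
  also have "\<dots> = c * ((of_nat m + 1) * ((of_nat m + 2) * (\<sigma> * (\<tau> * ?t)) - of_nat m * ((\<sigma> * ?s) * \<tau>)))"
    unfolding \<sigma> \<tau> N_def twice_card_plus_points by (simp add: algebra_simps)
  also have "\<dots> = c * ((of_nat m + 1) * (2 + \<alpha> * (of_nat m - 2)) * (\<sigma> * \<tau>))"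
    by (simp add: algebra_simps)
  finally show ?thesis unfolding central_charge_def by simp
qed

lemma central_charge_idem_hat:
  fixes \<alpha> c \<rho> \<sigma> :: "'a::field"
  assumes two: "(2::'a) \<noteq> 0" and j: "1 \<le> j" "j \<le> n"
    and \<sigma>: "\<sigma> * (1 + \<alpha> * (of_nat j - 1)) = 1"
    and \<rho>: "\<rho> * (1 + 2 * \<alpha> * (of_nat j - 1)) = 1"
  shows "central_charge \<alpha> c (double_A n)
      (scale \<rho> (point_sum (points (double_A j))) - scale \<sigma> (point_sum (plus_points j))) =
    c / 2 * (of_nat j * (of_nat j + 1) * (\<rho> * \<sigma>))"
proof -
  let ?P = "point_sum (points (double_A j)) :: _ \<Rightarrow>\<^sub>0 'a" and ?Q = "point_sum (plus_points j) :: _ \<Rightarrow>\<^sub>0 'a"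
  let ?s = "1 + \<alpha> * (of_nat j - 1)" and ?t = "1 + 2 * \<alpha> * (of_nat j - 1)"
  define N where "N = (of_nat (card (plus_points j)) :: 'a)"
  have sub: "plus_points j \<subseteq> points (double_A j)" by (auto simp: plus_points_def points_double_A)
  note big = regular_subsystem.matsuo_form_point_sum[OF regular_double_points[OF j] _ two, of _ \<alpha> c]
  note small = regular_subsystem.matsuo_form_point_sum[OF regular_plus_points[OF j] order.refl two, of \<alpha> c]
  have forms: "matsuo_form \<alpha> c (double_A n) ?P ?P = 2 * c * (2 * N) * ?t"
    "matsuo_form \<alpha> c (double_A n) ?P ?Q = 2 * c * N * ?t"
    "matsuo_form \<alpha> c (double_A n) ?Q ?P = 2 * c * N * ?t"
    "matsuo_form \<alpha> c (double_A n) ?Q ?Q = 2 * c * N * ?s"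
    using big(1)[OF order.refl] big(1)[OF sub] big(2)[OF sub] small(1)
    unfolding half_degree[OF two j(1)] N_def card_double_points by simp_all
  have "matsuo_form \<alpha> c (double_A n) (scale \<rho> ?P - scale \<sigma> ?Q) (scale \<rho> ?P - scale \<sigma> ?Q) =
     2 * c * (2 * N) * \<rho> * (\<rho> * ?t) - 2 * (2 * c * N * \<sigma>) * (\<rho> * ?t) + 2 * c * N * \<sigma> * (\<sigma> * ?s)"
    unfolding matsuo_form_diff_scale forms by (simp add: algebra_simps)
  also have "\<dots> = c * (2 * N) * (2 * \<rho> * (\<sigma> * ?s) - \<sigma> * (\<rho> * ?t))"
    unfolding \<sigma> \<rho> by (simp add: algebra_simps)
  also have "\<dots> = c * (of_nat j * (of_nat j + 1) * (\<rho> * \<sigma>))"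
    unfolding N_def twice_card_plus_points by (simp add: algebra_simps)
  finally show ?thesis unfolding central_charge_def by simp
qed


theorem theorem4p7:
  fixes \<alpha> c :: "'a::field" and n i :: nat
  assumes "n > i" and "i \<ge> 4"
    and "(2::'a) \<noteq> 0"
    and eta_denominators: "\<forall>j\<in>{i - 1, i, n}. 2 + 2 * \<alpha> * (of_nat j - 1) \<noteq> 0"
    and eta_hat_denominators: "\<forall>j\<in>{i - 1, i, n}. 1 + \<alpha> * (of_nat j - 1) \<noteq> 0"
    and cc_denominator: "(1 + \<alpha> * (of_nat i - 1)) * (1 + \<alpha> * (of_nat i - 2)) \<noteq> 0"
    and cc_hat_denominator: "(1 + 2 * \<alpha> * (of_nat i - 1)) * (1 + \<alpha> * (of_nat i - 1)) \<noteq> 0"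
    and identities: "\<forall>j\<in>{i - 1, i, n}. has_identity \<alpha> (double_graph (fischer_A n)) (sub_A j)"
    and identities_hat: "\<forall>j\<in>{i, n}. has_identity \<alpha> (double_graph (fischer_A n)) (sub_A_double j)"
  shows
    "Spec \<alpha> (double_graph (fischer_A n)) (idem \<alpha> n i) =
       {1, 0, eta \<alpha> i, 1 - eta \<alpha> (i - 1), eta \<alpha> i - eta \<alpha> (i - 1),
        eta_hat \<alpha> i - eta \<alpha> (i - 1), eta_hat \<alpha> i - eta_hat \<alpha> (i - 1)} \<and>
     Spec \<alpha> (double_graph (fischer_A n)) (idem_hat \<alpha> n n) =
       {1, 0, 1 - eta \<alpha> n, 1 - eta_hat \<alpha> n} \<and>
     central_charge \<alpha> c (double_graph (fischer_A n)) (idem \<alpha> n i) =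
       c / 2 * (of_nat i * (2 + \<alpha> * (of_nat i - 3)) /
                ((1 + \<alpha> * (of_nat i - 1)) * (1 + \<alpha> * (of_nat i - 2)))) \<and>
     central_charge \<alpha> c (double_graph (fischer_A n)) (idem_hat \<alpha> n i) =
       c / 2 * (of_nat i * (of_nat i + 1) /
                ((1 + 2 * \<alpha> * (of_nat i - 1)) * (1 + \<alpha> * (of_nat i - 1))))"
proof -
  note two = \<open>(2::'a) \<noteq> 0\<close>
  define m where "m = i - 1"
  have i: "i = Suc m" and m: "3 \<le> m" "Suc m < n" and n: "1 \<le> n" "3 \<le> n"
    and ij: "1 \<le> i" "i \<le> n" "1 \<le> m" "m \<le> n"
    using assms(1,2) by (simp_all add: m_def)
  have i1: "i - 1 = m" by (simp add: m_def)
  have of_nat_i: "of_nat i = (of_nat m + 1 :: 'a)" by (simp add: i)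
  define d where "d j = 1 + \<alpha> * (of_nat j - 1)" for j :: nat
  define d_hat where "d_hat j = 1 + 2 * \<alpha> * (of_nat j - 1)" for j :: nat
  have nz: "d m \<noteq> 0" "d i \<noteq> 0" "d n \<noteq> 0"
    using eta_hat_denominators unfolding i1 d_def by auto
  have ident: "ident \<alpha> n j = scale (1 / d j) (point_sum (plus_points j))" if "j \<in> {m, i, n}" for j
    unfolding d_def using that identities i1 ij n(1) by (intro ident_eq[OF two]) auto
  have ident_hat: "d_hat j \<noteq> 0"
    "ident_hat \<alpha> n j = scale (1 / d_hat j) (point_sum (points (double_A j)))" if "j \<in> {i, n}" for j
  proof -
    have "1 \<le> j" "j \<le> n" "has_identity \<alpha> (double_A n) (sub_A_double j)"
      using that identities_hat ij n(1) by auto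
    then show "d_hat j \<noteq> 0" "ident_hat \<alpha> n j = scale (1 / d_hat j) (point_sum (points (double_A j)))"
      unfolding d_hat_def by (rule ident_hat_eq[OF two])+
  qed
  have inv: "1 / d i * (1 + \<alpha> * of_nat m) = 1" "1 / d m * (1 + \<alpha> * (of_nat m - 1)) = 1"
    "1 / d i * (1 + \<alpha> * (of_nat i - 1)) = 1" "1 / d n * (1 + \<alpha> * (of_nat n - 1)) = 1"
    using nz by (simp_all add: d_def of_nat_i)
  have inv_hat: "1 / d_hat j * (1 + 2 * \<alpha> * (of_nat j - 1)) = 1" if "j \<in> {i, n}" for j
    using ident_hat(1)[OF that] by (simp add: d_hat_def)
  have eta: "eta \<alpha> j = \<alpha> / 2 * (1 / d j) * (of_nat j + 1)" for j
  proof -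
    have "2 + 2 * \<alpha> * (of_nat j - 1) = 2 * d j" by (simp add: d_def algebra_simps)
    then show ?thesis unfolding eta_def by simp
  qed
  have eta_hat: "eta_hat \<alpha> j = \<alpha> * (1 / d j) * of_nat j" for j
    unfolding eta_hat_def d_def by simp
  have idem: "idem \<alpha> n i = scale (1 / d i) (point_sum (plus_points (Suc m))) - scale (1 / d m) (point_sum (plus_points m))"
    unfolding idem_def i1 ident[of i, simplified] ident[of m, simplified] by (simp only: i)
  have idem_hat: "idem_hat \<alpha> n j = scale (1 / d_hat j) (point_sum (points (double_A j))) - scale (1 / d j) (point_sum (plus_points j))"
    if "j \<in> {i, n}" for j
    unfolding idem_hat_def using that ident ident_hat by auto
  have "Spec \<alpha> (double_A n) (idem \<alpha> n i) =
       {1, 0, eta \<alpha> i, 1 - eta \<alpha> (i - 1), eta \<alpha> i - eta \<alpha> (i - 1),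
        eta_hat \<alpha> i - eta \<alpha> (i - 1), eta_hat \<alpha> i - eta_hat \<alpha> (i - 1)}"
    unfolding idem spectrum_idem[OF two m(2,1) inv(1,2)] i1 eta eta_hat of_nat_i by (simp add: add.assoc)
  moreover have "Spec \<alpha> (double_A n) (idem_hat \<alpha> n n) = {1, 0, 1 - eta \<alpha> n, 1 - eta_hat \<alpha> n}"
    unfolding idem_hat[OF insertI2[OF singletonI]] spectrum_idem_hat[OF two n(2) inv(4) inv_hat[OF insertI2[OF singletonI]]] eta eta_hat
    by simp
  moreover have "central_charge \<alpha> c (double_A n) (idem \<alpha> n i) =
       c / 2 * (of_nat i * (2 + \<alpha> * (of_nat i - 3)) /
                ((1 + \<alpha> * (of_nat i - 1)) * (1 + \<alpha> * (of_nat i - 2))))"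
    unfolding idem central_charge_idem[OF two ij(3) less_imp_le[OF m(2)] inv(1,2)]
    unfolding d_def of_nat_i by (simp add: algebra_simps)
  moreover have "central_charge \<alpha> c (double_A n) (idem_hat \<alpha> n i) =
       c / 2 * (of_nat i * (of_nat i + 1) /
                ((1 + 2 * \<alpha> * (of_nat i - 1)) * (1 + \<alpha> * (of_nat i - 1))))"
    unfolding idem_hat[OF insertI1] central_charge_idem_hat[OF two ij(1,2) inv(3) inv_hat[OF insertI1]]
    unfolding d_def d_hat_def by simp
  ultimately show ?thesis by blast
qed

end
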